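(* Consider the system on the circle $S^1=\mathbb{R}/2\pi\mathbb{Z}$ (with angle variable $\theta$, and $'=d/d\theta$) for smooth real-valued functions $f=f(\theta)$, $v=v(\theta)$, $p=p(\theta)$: $$(p-2f)'=0,\qquad -f''+vf'-f^2-|v|^2-2p=0,\qquad v'=0.$$ The solutions of this system satisfying the zero flux condition $\int_{S^1}f=0$ are of the following form. Either $$f=0,\qquad v=\text{const.},\qquad p=-|v|^2/2,$$ or $$f(\theta)=\tilde f_k(\theta-\theta_0),\qquad v=0,\qquad p=-f/2+c_k,\qquad k=3,4,\dots,$$ where for each $k=3,4,\dots$ the function $\tilde f_k$ is a non-trivial periodic function of $\theta$ with minimal period $2\pi/k$, the constant $c_k$ is given by $c_k=\frac12\int_{S^1}|\tilde f_k|^2$, and $\theta_0$ can be chosen arbitrarily. The functions $\tilde f_k$ can be expressed in terms of the classical elliptic functions. The amplitude of oscillations of $\tilde f_k$ is of order $k^2$.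
   Context: The system is the reduction to the unit circle of the two-dimensional steady Navier-Stokes equations $-\Delta u+u\nabla u+\nabla p=0$, $\operatorname{div}u=0$ in $\mathbb{R}^2\setminus\{0\}$ for velocity fields $u$, smooth away from the origin, that are $(-1)$-homogeneous (i.e. $\lambda u(\lambda x)=u(x)$ for all $\lambda>0$), with $(-2)$-homogeneous pressure: $v$ is the component of the velocity tangent to the circle, $f$ is the component normal to the circle, and $p$ is the pressure, all restricted to $S^1$.
   Formalization: The pressure in the second family is corrected from p = −f/2 + c_k, c_k = ½∫|f̃_k|² to p = 2f + c_k, c_k = −(1/4π)∫|f̃_k|², since (p−2f)′ = 0 with the printed p would force f to be constant, and integrating the second equation fixes c_k. *)

theory Defs
  imports "HOL-Analysis.Analysis" "HOL-Library.Periodic_Fun" "HOL-Library.Landau_Symbols"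
begin

text \<open>
  Functions on the circle R/2piZ are represented by 2pi-periodic functions on the real line, and
  integrals over the circle by integrals over the interval from 0 to 2pi.
\<close>

definition smooth :: "(real \<Rightarrow> real) \<Rightarrow> bool" where
  "smooth g \<longleftrightarrow> (\<forall>n x. (deriv ^^ n) g differentiable (at x))"

definition smooth_circle_fun :: "(real \<Rightarrow> real) \<Rightarrow> bool" where
  "smooth_circle_fun g \<longleftrightarrow> smooth g \<and> periodic_fun_simple g (2 * pi)"

definition circle_integral :: "(real \<Rightarrow> real) \<Rightarrow> real" where
  "circle_integral g = integral {0..2 * pi} g"

definition minimal_period :: "(real \<Rightarrow> 'b) \<Rightarrow> real \<Rightarrow> bool" where
  "minimal_period g T \<longleftrightarrow>
     0 < T \<and> periodic_fun_simple g T \<and> (\<forall>S. 0 < S \<and> S < T \<longrightarrow> \<not> periodic_fun_simple g S)"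

definition amplitude :: "(real \<Rightarrow> real) \<Rightarrow> real" where
  "amplitude g = (Sup (range g) - Inf (range g)) / 2"

text \<open>
  The system satisfied on the unit circle by the normal velocity f, the tangential velocity v and
  the pressure p.
\<close>

definition circle_NS :: "(real \<Rightarrow> real) \<Rightarrow> (real \<Rightarrow> real) \<Rightarrow> (real \<Rightarrow> real) \<Rightarrow> bool" where
  "circle_NS f v p \<longleftrightarrow>
     (\<forall>\<theta>. deriv (\<lambda>t. p t - 2 * f t) \<theta> = 0) \<and>
     (\<forall>\<theta>. - deriv (deriv f) \<theta> + v \<theta> * deriv f \<theta> - (f \<theta>)\<^sup>2 - \<bar>v \<theta>\<bar>\<^sup>2 - 2 * p \<theta> = 0) \<and>
     (\<forall>\<theta>. deriv v \<theta> = 0)"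

text \<open>
  Jacobi's elliptic functions by inversion of Legendre's incomplete elliptic integral of the first
  kind. The argument m is the parameter, that is, the square of the modulus. For m < 1 the integral
  is an increasing bijection of the real line, so that the inverse below is a genuine one; no
  meaning is attached to the definitions for other m.
\<close>

definition elliptic_F :: "real \<Rightarrow> real \<Rightarrow> real" where
  "elliptic_F m \<phi> = (LBINT t=0..ereal \<phi>. 1 / sqrt (1 - m * (sin t)\<^sup>2))"

definition jacobi_am :: "real \<Rightarrow> real \<Rightarrow> real" where
  "jacobi_am m = inv (elliptic_F m)"

definition jacobi_cn :: "real \<Rightarrow> real \<Rightarrow> real" where
  "jacobi_cn m u = cos (jacobi_am m u)"

text \<open>
  The constant in the pressure p = 2 f + c of a solution with v = 0 and zero flux: integrating
  - f'' - f^2 - 2 p = 0 over the circle gives 4 pi c = - (integral of f^2), so that c is minus one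
  half of the mean value of f^2.
\<close>

definition pressure_const :: "(real \<Rightarrow> real) \<Rightarrow> real" where
  "pressure_const g = - (1 / 2) * (1 / (2 * pi) * circle_integral (\<lambda>\<theta>. \<bar>g \<theta>\<bar>\<^sup>2))"

end

theory Submission
  imports Defs
begin

text \<open>
  The first and third equations give \<open>p = 2 f + c\<close> and a constant \<open>v\<close>. Multiplying the second
  equation by \<open>f'\<close> shows that an energy grows at the rate \<open>v f'\<^sup>2\<close>, so on the circle either \<open>f\<close> is
  constant, hence zero, or \<open>v = 0\<close> and \<open>f'' = - f\<^sup>2 - 4 f - 2 c\<close>. By conservation of energy and
  uniqueness for this equation, its nonconstant periodic solutions are the cnoidal waves
  \<open>a + b cn\<^sup>2(\<kappa> (\<theta> - \<theta>\<^sub>0))\<close> with \<open>a\<close> and \<open>b\<close> determined by \<open>m\<close> and \<open>\<kappa>\<close>. If there are \<open>n\<close> oscillations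
  on the circle, zero flux means \<open>n\<^sup>2 K ((m - 2) K + 3 E) = \<pi>\<^sup>2\<close> in terms of Legendre's complete
  integrals. The function \<open>K ((m - 2) K + 3 E)\<close> of \<open>m\<close> strictly decreases, by the Cauchy--Schwarz
  inequality, from \<open>\<pi>\<^sup>2 / 4\<close> at \<open>m = 0\<close> to nonpositive values near \<open>m = 1\<close>, so there is exactly one \<open>m\<close>
  for each \<open>n \<ge> 3\<close> and none for smaller \<open>n\<close>.
\<close>

section \<open>The integrand of Legendre's integrals\<close>

lemma modular_pos:
  fixes m t :: real
  assumes "m < 1"
  shows "0 < 1 - m * (sin t)\<^sup>2"
proof (cases "m \<le> 0")
  case True
  then have "m * (sin t)\<^sup>2 \<le> 0"
    by (simp add: mult_nonpos_nonneg)
  then show ?thesis by linarith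
next
  case False
  have "(sin t)\<^sup>2 \<le> 1"
    by (simp add: abs_square_le_1)
  then have "m * (sin t)\<^sup>2 \<le> m"
    using False by (simp add: mult_left_le)
  with assms show ?thesis by linarith
qed

text \<open>Legendre's delta amplitude: composed with \<open>jacobi_am m\<close> it is Jacobi's
  dn.\<close>

definition dn_amp :: "real \<Rightarrow> real \<Rightarrow> real" where
  "dn_amp m t = sqrt (1 - m * (sin t)\<^sup>2)"

lemma dn_amp_pos: "m < 1 \<Longrightarrow> 0 < dn_amp m t"
  unfolding dn_amp_def using modular_pos by simp

lemma dn_amp_nz: "m < 1 \<Longrightarrow> dn_amp m t \<noteq> 0"
  using dn_amp_pos[of m t] by simp

lemma dn_amp_square: "m < 1 \<Longrightarrow> (dn_amp m t)\<^sup>2 = 1 - m * (sin t)\<^sup>2"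
  unfolding dn_amp_def using modular_pos[of m t] by simp

lemma dn_amp_le_1: "0 \<le> m \<Longrightarrow> dn_amp m t \<le> 1"
  unfolding dn_amp_def by simp

lemma dn_amp_plus_pi: "dn_amp m (t + pi) = dn_amp m t"
  unfolding dn_amp_def by simp

lemma dn_amp_deriv_amplitude:
  assumes "m < 1"
  shows "(dn_amp m has_real_derivative - m * sin t * cos t / dn_amp m t) (at t)"
  unfolding dn_amp_def using modular_pos[OF assms, of t]
  by (auto intro!: derivative_eq_intros simp: field_simps)

lemma dn_amp_deriv_parameter:
  assumes "m < 1"
  shows "((\<lambda>m. dn_amp m t) has_real_derivative - (sin t)\<^sup>2 / (2 * dn_amp m t)) (at m)"
  unfolding dn_amp_def using modular_pos[OF assms, of t]
  by (auto intro!: derivative_eq_intros simp: field_simps)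

lemma continuous_on_dn_amp [continuous_intros]:
  fixes f g :: "'a :: t2_space \<Rightarrow> real"
  assumes "continuous_on A f" "continuous_on A g"
  shows "continuous_on A (\<lambda>x. dn_amp (f x) (g x))"
  unfolding dn_amp_def by (intro continuous_intros assms)

section \<open>Complete elliptic integrals\<close>

text \<open>The integrals run over the period \<open>[0, \<pi>]\<close> of the integrands, so these are twice Legendre's
  complete integrals.\<close>

definition complete_K :: "real \<Rightarrow> real" where
  "complete_K m = integral {0..pi} (\<lambda>t. 1 / dn_amp m t)"

definition complete_E :: "real \<Rightarrow> real" where
  "complete_E m = integral {0..pi} (dn_amp m)"

lemma has_integral_complete_K:
  "m < 1 \<Longrightarrow> ((\<lambda>t. 1 / dn_amp m t) has_integral complete_K m) {0..pi}"
  unfolding complete_K_def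
  by (intro integrable_integral integrable_continuous_real continuous_intros ballI)
     (auto simp: dn_amp_nz)

lemma has_integral_complete_E:
  "(dn_amp m has_integral complete_E m) {0..pi}"
  unfolding complete_E_def
  by (intro integrable_integral integrable_continuous_real continuous_intros)

lemma complete_K_ge_pi:
  assumes "0 \<le> m" "m < 1"
  shows "pi \<le> complete_K m"
proof -
  have 1: "((\<lambda>t. 1) has_integral pi) {0..pi}"
    using has_integral_const_real[of "1::real" 0 pi] by simp
  show ?thesis
    by (rule has_integral_le[OF 1 has_integral_complete_K])
       (use assms dn_amp_pos dn_amp_le_1 in \<open>auto simp: le_divide_eq_1\<close>)
qed

lemma complete_K_pos:
  assumes "0 \<le> m" "m < 1"
  shows "0 < complete_K m"
  using complete_K_ge_pi[OF assms] pi_gt_zero by linarith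

lemma complete_E_le_pi:
  assumes "0 \<le> m" "m < 1"
  shows "complete_E m \<le> pi"
proof -
  have 1: "((\<lambda>t. 1) has_integral pi) {0..pi}"
    using has_integral_const_real[of "1::real" 0 pi] by simp
  show ?thesis
    by (rule has_integral_le[OF has_integral_complete_E 1])
       (use assms dn_amp_le_1 in auto)
qed

lemma complete_K_0: "complete_K 0 = pi" and complete_E_0: "complete_E 0 = pi"
  by (simp_all add: complete_K_def complete_E_def dn_amp_def[abs_def])

text \<open>Differentiation under the integral sign. The Leibniz rule works on a convex parameter
  set; the half-line \<open>m < 1\<close> is convex, and since it is open the derivative within it
  is the full one.\<close>

lemma complete_K_deriv:
  assumes "m < 1"
  shows "(complete_K has_real_derivative
           integral {0..pi} (\<lambda>t. (sin t)\<^sup>2 / (2 * (dn_amp m t)^3))) (at m)"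
proof -
  have "((\<lambda>m. integral (cbox 0 pi) (\<lambda>t. 1 / dn_amp m t)) has_real_derivative
          integral (cbox 0 pi) (\<lambda>t. (sin t)\<^sup>2 / (2 * (dn_amp m t)^3))) (at m within {..<1})"
  proof (rule leibniz_rule_field_derivative)
    fix x t :: real assume "x \<in> {..<1}"
    then have x: "x < 1" by simp
    show "((\<lambda>x. 1 / dn_amp x t) has_real_derivative (sin t)\<^sup>2 / (2 * (dn_amp x t)^3))
            (at x within {..<1})"
      using dn_amp_nz[OF x, of t]
      by (auto intro!: derivative_eq_intros DERIV_subset[OF dn_amp_deriv_parameter[OF x]]
               simp: field_simps power3_eq_cube)
  next
    fix x :: real assume "x \<in> {..<1}"
    then have x: "x < 1" by simp
    show "(\<lambda>t. 1 / dn_amp x t) integrable_on cbox 0 pi"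
      using has_integral_complete_K[OF x] by auto
  next
    show "continuous_on ({..<1} \<times> cbox 0 pi) (\<lambda>(x, t). (sin t)\<^sup>2 / (2 * (dn_amp x t)^3))"
      unfolding case_prod_beta by (intro continuous_intros) (auto simp: dn_amp_nz)
  qed (use assms in auto)
  moreover have "at m within {..<1} = at m"
    by (rule at_within_open) (use assms in auto)
  ultimately show ?thesis
    unfolding complete_K_def[abs_def] by simp
qed

lemma complete_E_deriv:
  assumes "m < 1"
  shows "(complete_E has_real_derivative
           integral {0..pi} (\<lambda>t. - (sin t)\<^sup>2 / (2 * dn_amp m t))) (at m)"
proof -
  have "((\<lambda>m. integral (cbox 0 pi) (dn_amp m)) has_real_derivative
          integral (cbox 0 pi) (\<lambda>t. - (sin t)\<^sup>2 / (2 * dn_amp m t))) (at m within {..<1})"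
  proof (rule leibniz_rule_field_derivative)
    fix x t :: real assume "x \<in> {..<1}"
    then have x: "x < 1" by simp
    show "((\<lambda>x. dn_amp x t) has_real_derivative - (sin t)\<^sup>2 / (2 * dn_amp x t))
            (at x within {..<1})"
      by (rule DERIV_subset[OF dn_amp_deriv_parameter[OF x]]) auto
  next
    fix x :: real assume "x \<in> {..<1}"
    show "dn_amp x integrable_on cbox 0 pi"
      using has_integral_complete_E[of x] by auto
  next
    show "continuous_on ({..<1} \<times> cbox 0 pi) (\<lambda>(x, t). - (sin t)\<^sup>2 / (2 * dn_amp x t))"
      unfolding case_prod_beta by (intro continuous_intros) (auto simp: dn_amp_nz)
  qed (use assms in auto)
  moreover have "at m within {..<1} = at m"
    by (rule at_within_open) (use assms in auto)
  ultimately show ?thesis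
    unfolding complete_E_def[abs_def] by simp
qed

text \<open>Since m sin^2 = 1 - dn^2, the differentiated integrand becomes a combination of dn and 1
  / dn. Keeping the factor \<open>m\<close> on the left avoids dividing by it.\<close>

lemma complete_E_deriv_relation:
  assumes "m < 1" "(complete_E has_real_derivative E') (at m)"
  shows "2 * m * E' = complete_E m - complete_K m"
proof -
  have E': "E' = integral {0..pi} (\<lambda>t. - (sin t)\<^sup>2 / (2 * dn_amp m t))"
    using DERIV_unique[OF assms(2) complete_E_deriv[OF assms(1)]] .
  have "2 * m * (- (sin t)\<^sup>2 / (2 * dn_amp m t)) = dn_amp m t - 1 / dn_amp m t" for t
    using dn_amp_square[OF assms(1), of t] dn_amp_nz[OF assms(1), of t]
    by (simp add: field_simps power2_eq_square)
  then have "2 * m * E' = integral {0..pi} (\<lambda>t. dn_amp m t - 1 / dn_amp m t)"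
    unfolding E' integral_mult_right[symmetric] by simp
  also have "\<dots> = complete_E m - complete_K m"
    by (intro integral_unique has_integral_diff has_integral_complete_E
        has_integral_complete_K assms)
  finally show ?thesis .
qed

text \<open>Here \<open>\<integral> 1 / dn_amp\<^sup>3\<close> is eliminated with the derivative of \<open>m sin cos / dn_amp\<close>.\<close>

lemma complete_K_deriv_relation:
  assumes "m < 1" "(complete_K has_real_derivative K') (at m)"
  shows "2 * m * (1 - m) * K' = complete_E m - (1 - m) * complete_K m"
proof -
  define D where "D = dn_amp m"
  have Dnz: "D t \<noteq> 0" and D2: "(D t)\<^sup>2 = 1 - m * (sin t)\<^sup>2"
    and DD: "(D has_real_derivative - m * sin t * cos t / D t) (at t)" for t
    unfolding D_def using dn_amp_nz[OF assms(1)] dn_amp_square[OF assms(1)]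
      dn_amp_deriv_amplitude[OF assms(1)] by auto
  have [continuous_intros]: "continuous_on A D" for A
    unfolding D_def by (intro continuous_intros)
  define J where "J = integral {0..pi} (\<lambda>t. 1 / (D t)^3)"
  have J: "((\<lambda>t. 1 / (D t)^3) has_integral J) {0..pi}"
    unfolding J_def
    by (intro integrable_integral integrable_continuous_real continuous_intros) (auto simp: Dnz)
  have K': "K' = integral {0..pi} (\<lambda>t. (sin t)\<^sup>2 / (2 * (D t)^3))"
    unfolding D_def using DERIV_unique[OF assms(2) complete_K_deriv[OF assms(1)]] .
  have "2 * m * ((sin t)\<^sup>2 / (2 * (D t)^3)) = 1 / (D t)^3 - 1 / D t" for t
  proof -
    have "2 * m * ((sin t)\<^sup>2 / (2 * (D t)^3)) = (m * (sin t)\<^sup>2) / (D t)^3" by simp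
    also have "m * (sin t)\<^sup>2 = 1 - (D t)\<^sup>2" using D2[of t] by simp
    finally show ?thesis using Dnz[of t]
      by (simp add: diff_divide_distrib power2_eq_square power3_eq_cube)
  qed
  then have "2 * m * K' = integral {0..pi} (\<lambda>t. 1 / (D t)^3 - 1 / D t)"
    unfolding K' integral_mult_right[symmetric] by simp
  also have "\<dots> = J - complete_K m"
    unfolding D_def
    by (intro integral_unique has_integral_diff J[unfolded D_def]
        has_integral_complete_K assms)
  finally have 1: "2 * m * K' = J - complete_K m" .
  have "((\<lambda>t. m * sin t * cos t / D t) has_real_derivative D t - (1 - m) * (1 / (D t)^3)) (at t)" for t
  proof -
    have "((\<lambda>t. m * sin t * cos t / D t) has_real_derivative
        ((m * cos t * cos t - m * sin t * sin t) * D t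
          - m * sin t * cos t * (- m * sin t * cos t / D t)) / (D t * D t)) (at t)"
      by (rule derivative_eq_intros DD refl Dnz)+ (simp add: algebra_simps)
    also have "((m * cos t * cos t - m * sin t * sin t) * D t
          - m * sin t * cos t * (- m * sin t * cos t / D t)) / (D t * D t)
        = (m * ((cos t)\<^sup>2 - (sin t)\<^sup>2) * (D t)\<^sup>2 + m\<^sup>2 * (sin t)\<^sup>2 * (cos t)\<^sup>2) / (D t)^3"
      using Dnz[of t] by (simp add: field_simps power2_eq_square power3_eq_cube)
    also have "m * ((cos t)\<^sup>2 - (sin t)\<^sup>2) * (D t)\<^sup>2 + m\<^sup>2 * (sin t)\<^sup>2 * (cos t)\<^sup>2
        = ((D t)\<^sup>2)\<^sup>2 - (1 - m)"
      unfolding D2 cos_squared_eq by (simp add: algebra_simps power2_eq_square)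
    also have "(((D t)\<^sup>2)\<^sup>2 - (1 - m)) / (D t)^3 = D t - (1 - m) * (1 / (D t)^3)"
      using Dnz[of t] by (simp add: field_simps power2_eq_square power3_eq_cube)
    finally show ?thesis .
  qed
  \<comment> \<open>The boundary terms vanish with sin, so comparison with \<open>i2\<close> gives
    \<open>(1 - m) * J = complete_E m\<close>.\<close>
  then have i1: "((\<lambda>t. D t - (1 - m) * (1 / (D t)^3)) has_integral
      (m * sin pi * cos pi / D pi - m * sin 0 * cos 0 / D 0)) {0..pi}"
    by (intro fundamental_theorem_of_calculus)
       (auto simp: has_real_derivative_iff_has_vector_derivative[symmetric]
             intro: DERIV_subset)
  have i2: "((\<lambda>t. D t - (1 - m) * (1 / (D t)^3)) has_integral
      complete_E m - (1 - m) * J) {0..pi}"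
    by (intro has_integral_diff has_integral_mult_right J)
       (unfold D_def, rule has_integral_complete_E)
  have "complete_E m - (1 - m) * J = 0"
    using has_integral_unique[OF i1 i2] by simp
  moreover have "2 * m * (1 - m) * K' = (1 - m) * (2 * m * K')" by simp
  ultimately show ?thesis unfolding 1 by (simp add: algebra_simps)
qed

text \<open>This is the Cauchy--Schwarz inequality for \<open>dn_amp\<^sup>2\<close> with respect to the measure
  \<open>dt / dn_amp\<close>; the second moment \<open>\<integral> dn_amp\<^sup>3\<close> is eliminated with the derivative of
  \<open>m sin cos dn_amp\<close>.\<close>

lemma complete_integrals_inequality:
  assumes "0 < m" "m < 1"
  shows "(1 - m) * (complete_K m)\<^sup>2 + 2 * (m - 2) * complete_K m * complete_E m
           + 3 * (complete_E m)\<^sup>2 < 0"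
proof -
  define D K E where "D = dn_amp m" and "K = complete_K m" and "E = complete_E m"
  have Dpos: "0 < D t" and Dnz: "D t \<noteq> 0" and D2: "(D t)\<^sup>2 = 1 - m * (sin t)\<^sup>2"
    and DD: "(D has_real_derivative - m * sin t * cos t / D t) (at t)" for t
    unfolding D_def using dn_amp_pos[OF assms(2)] dn_amp_nz[OF assms(2)]
      dn_amp_square[OF assms(2)] dn_amp_deriv_amplitude[OF assms(2)] by auto
  have [continuous_intros]: "continuous_on A D" for A
    unfolding D_def by (intro continuous_intros)
  have hK: "((\<lambda>t. 1 / D t) has_integral K) {0..pi}" and hE: "(D has_integral E) {0..pi}"
    unfolding D_def K_def E_def
    using has_integral_complete_K[OF assms(2)] has_integral_complete_E by auto
  define L where "L = integral {0..pi} (\<lambda>t. (D t)^3)"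
  have hL: "((\<lambda>t. (D t)^3) has_integral L) {0..pi}"
    unfolding L_def by (intro integrable_integral integrable_continuous_real continuous_intros)
  have Kpos: "0 < K"
    using complete_K_pos[of m] assms unfolding K_def by simp
  have "((\<lambda>t. m * sin t * cos t * D t) has_real_derivative
      3 * (D t)^3 - 2 * (2 - m) * D t + (1 - m) * (1 / D t)) (at t)" for t
  proof -
    have "((\<lambda>t. m * sin t * cos t * D t) has_real_derivative
        (m * cos t * cos t - m * sin t * sin t) * D t
          + m * sin t * cos t * (- m * sin t * cos t / D t)) (at t)"
      by (rule derivative_eq_intros DD refl Dnz)+ (simp add: algebra_simps)
    also have "(m * cos t * cos t - m * sin t * sin t) * D t
          + m * sin t * cos t * (- m * sin t * cos t / D t)
        = (m * ((cos t)\<^sup>2 - (sin t)\<^sup>2) * (D t)\<^sup>2 - m\<^sup>2 * (sin t)\<^sup>2 * (cos t)\<^sup>2) / D t"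
      using Dnz[of t] by (simp add: field_simps power2_eq_square)
    also have "m * ((cos t)\<^sup>2 - (sin t)\<^sup>2) * (D t)\<^sup>2 - m\<^sup>2 * (sin t)\<^sup>2 * (cos t)\<^sup>2
        = 3 * ((D t)\<^sup>2)\<^sup>2 - 2 * (2 - m) * (D t)\<^sup>2 + (1 - m)"
      unfolding D2 cos_squared_eq by (simp add: algebra_simps power2_eq_square)
    also have "(3 * ((D t)\<^sup>2)\<^sup>2 - 2 * (2 - m) * (D t)\<^sup>2 + (1 - m)) / D t
        = 3 * (D t)^3 - 2 * (2 - m) * D t + (1 - m) * (1 / D t)"
      using Dnz[of t] by (simp add: field_simps power2_eq_square power3_eq_cube)
    finally show ?thesis .
  qed
  then have i1: "((\<lambda>t. 3 * (D t)^3 - 2 * (2 - m) * D t + (1 - m) * (1 / D t)) has_integral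
      (m * sin pi * cos pi * D pi - m * sin 0 * cos 0 * D 0)) {0..pi}"
    by (intro fundamental_theorem_of_calculus)
       (auto simp: has_real_derivative_iff_has_vector_derivative[symmetric]
             intro: DERIV_subset)
  have i2: "((\<lambda>t. 3 * (D t)^3 - 2 * (2 - m) * D t + (1 - m) * (1 / D t)) has_integral
      3 * L - 2 * (2 - m) * E + (1 - m) * K) {0..pi}"
    by (intro has_integral_diff has_integral_add has_integral_mult_right hL hE hK)
  have L: "3 * L = 2 * (2 - m) * E - (1 - m) * K"
    using has_integral_unique[OF i1 i2] by simp
  \<comment> \<open>The mean of \<open>D\<^sup>2\<close> for the measure dt / D, so that the
    integral of \<open>?g\<close> is a variance up to normalization.\<close>
  define r where "r = E / K"
  let ?g = "\<lambda>t. ((D t)\<^sup>2 - r)\<^sup>2 * (1 / D t)"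
  have "?g t = (D t)^3 - 2 * r * D t + r\<^sup>2 * (1 / D t)" for t
    using Dnz[of t] by (simp add: field_simps power2_eq_square power3_eq_cube)
  then have hg: "(?g has_integral L - 2 * r * E + r\<^sup>2 * K) {0..pi}"
    by (simp only:) (intro has_integral_diff has_integral_add has_integral_mult_right hL hE hK)
  have cg: "continuous_on {0..pi} ?g"
    by (intro continuous_intros) (auto simp: Dnz)
  have gpos: "0 \<le> ?g t" for t
    using Dpos[of t] by (intro mult_nonneg_nonneg) auto
  have "integral {0..pi} ?g \<noteq> 0"
  proof
    assume "integral {0..pi} ?g = 0"
    then have "\<forall>t\<in>{0..pi}. ?g t = 0"
      using integral_eq_0_iff[OF cg pi_gt_zero gpos] by blast
    \<comment> \<open>Strictness: \<open>D\<^sup>2\<close> is 1 at 0 and 1 - m at pi / 2, so it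
      cannot equal \<open>r\<close> at both points.\<close>
    then have "?g 0 = 0" "?g (pi / 2) = 0" using pi_gt_zero by auto
    then have "(D 0)\<^sup>2 = r" "(D (pi / 2))\<^sup>2 = r" using Dnz by auto
    then show False using assms unfolding D2 by simp
  qed
  moreover have "0 \<le> integral {0..pi} ?g"
    by (rule integral_nonneg[OF _ gpos]) (use hg in auto)
  ultimately have "0 < L - 2 * r * E + r\<^sup>2 * K"
    using integral_unique[OF hg] by linarith
  also have "L - 2 * r * E + r\<^sup>2 * K = L - E\<^sup>2 / K"
    unfolding r_def using Kpos by (simp add: field_simps power2_eq_square)
  finally have "E\<^sup>2 < L * K"
    using Kpos by (simp add: field_simps)
  moreover have "3 * (L * K) = (2 * (2 - m) * E - (1 - m) * K) * K"
    unfolding L[symmetric] by simp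
  ultimately show ?thesis
    unfolding K_def[symmetric] E_def[symmetric]
    by (simp add: algebra_simps power2_eq_square)
qed

section \<open>Monotonicity and range of the flux function\<close>

text \<open>A cnoidal solution with \<open>n\<close> oscillations on the circle has zero mean iff
  \<open>n\<^sup>2 flux_modulus m = 4 \<pi>\<^sup>2\<close>.\<close>

definition flux_modulus :: "real \<Rightarrow> real" where
  "flux_modulus m = complete_K m * ((m - 2) * complete_K m + 3 * complete_E m)"

text \<open>After multiplication by 2 m (1 - m) the two derivative relations eliminate K' and E',
  and what remains is the quadratic form in K and E already known to be negative.\<close>

lemma flux_modulus_deriv:
  assumes "0 < m" "m < 1"
  shows "\<exists>d. (flux_modulus has_real_derivative d) (at m) \<and> d < 0"
proof -
  define K E where "K = complete_K m" and "E = complete_E m"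
  obtain K' where K': "(complete_K has_real_derivative K') (at m)"
    using complete_K_deriv[OF assms(2)] by blast
  obtain E' where E': "(complete_E has_real_derivative E') (at m)"
    using complete_E_deriv[OF assms(2)] by blast
  note relK = complete_K_deriv_relation[OF assms(2) K', folded K_def E_def]
  note relE = complete_E_deriv_relation[OF assms(2) E', folded K_def E_def]
  define d where "d = K' * ((m - 2) * K + 3 * E) + (K + (m - 2) * K' + 3 * E') * K"
  have "(flux_modulus has_real_derivative d) (at m)"
    unfolding flux_modulus_def[abs_def] d_def K_def E_def
    by (rule derivative_eq_intros K' E' refl)+ (simp add: algebra_simps)
  moreover have "2 * m * (1 - m) * d = (1 - m) * K\<^sup>2 + 2 * (m - 2) * K * E + 3 * E\<^sup>2"
  proof -
    have "2 * m * (1 - m) * d = (2 * m * (1 - m) * K') * (2 * (m - 2) * K + 3 * E)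
        + 2 * m * (1 - m) * K\<^sup>2 + 3 * (1 - m) * (2 * m * E') * K"
      unfolding d_def by (simp add: algebra_simps power2_eq_square)
    also have "\<dots> = (1 - m) * K\<^sup>2 + 2 * (m - 2) * K * E + 3 * E\<^sup>2"
      unfolding relK relE by (simp add: algebra_simps power2_eq_square)
    finally show ?thesis .
  qed
  with complete_integrals_inequality[OF assms] have "2 * m * (1 - m) * d < 0"
    unfolding K_def E_def by simp
  then have "d < 0"
    using assms by (simp add: mult_less_0_iff zero_less_mult_iff)
  ultimately show ?thesis by blast
qed

lemma flux_modulus_isCont:
  assumes "m < 1"
  shows "isCont flux_modulus m"
  unfolding flux_modulus_def[abs_def]
  using DERIV_isCont[OF complete_K_deriv[OF assms]] DERIV_isCont[OF complete_E_deriv[OF assms]]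
  by (intro continuous_intros) auto

text \<open>The sign of the derivative is known only for positive parameters; at the left endpoint 0
  continuity takes over.\<close>

lemma flux_modulus_strict_antimono:
  assumes "0 \<le> m1" "m1 < m2" "m2 < 1"
  shows "flux_modulus m2 < flux_modulus m1"
proof (rule DERIV_neg_imp_decreasing_open[OF assms(2)])
  show "\<exists>d. (flux_modulus has_real_derivative d) (at m) \<and> d < 0" if "m1 < m" "m < m2" for m
    using flux_modulus_deriv[of m] that assms by auto
  show "continuous_on {m1..m2} flux_modulus"
    using flux_modulus_isCont assms by (intro continuous_at_imp_continuous_on) auto
qed

lemma flux_modulus_0: "flux_modulus 0 = pi\<^sup>2"
  by (simp add: flux_modulus_def complete_K_0 complete_E_0 power2_eq_square)

text \<open>The logarithmic divergence of \<open>complete_K m\<close> as \<open>m \<rightarrow> 1\<close>, from \<open>cos t \<le> \<pi>/2 - t\<close>.\<close>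

lemma complete_K_ge_ln:
  assumes "0 \<le> m" "m < 1"
  shows "ln ((pi / 2) / sqrt (1 - m)) \<le> complete_K m"
proof -
  \<comment> \<open>The value of dn at pi / 2. Bounding dn by cos t + s and then by pi / 2 - t + s
    leaves a reciprocal with a logarithmic primitive.\<close>
  define s where "s = sqrt (1 - m)"
  have s: "0 < s" "s\<^sup>2 = 1 - m" using assms by (auto simp: s_def)
  let ?h = "\<lambda>t. 1 / (pi / 2 - t + s)"
  have "((\<lambda>t. - ln (pi / 2 - t + s)) has_real_derivative ?h t) (at t within A)"
    if "t \<in> {0..pi/2}" for t A
    using that s by (auto intro!: derivative_eq_intros)
  then have h: "(?h has_integral (- ln (pi / 2 - pi / 2 + s) - - ln (pi / 2 - 0 + s))) {0..pi/2}"
    by (intro fundamental_theorem_of_calculus)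
       (auto simp: has_real_derivative_iff_has_vector_derivative[symmetric])
  have le: "?h t \<le> 1 / dn_amp m t" if "t \<in> {0..pi/2}" for t
  proof -
    have "cos t = sin (pi / 2 - t)" by (simp add: sin_diff)
    also have "\<dots> \<le> pi / 2 - t" using that by (intro sin_x_le_x) auto
    finally have c: "cos t \<le> pi / 2 - t" .
    have c0: "0 \<le> cos t" using that by (intro cos_ge_zero) auto
    have "1 - m * (sin t)\<^sup>2 = (cos t)\<^sup>2 + (1 - m) * (sin t)\<^sup>2"
      unfolding cos_squared_eq by (simp add: algebra_simps)
    also have "\<dots> \<le> (cos t)\<^sup>2 + (1 - m) * 1"
      using assms by (intro add_left_mono mult_left_mono) (auto simp: abs_square_le_1)
    also have "\<dots> = (cos t)\<^sup>2 + s\<^sup>2" using s by simp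
    also have "\<dots> \<le> (cos t + s)\<^sup>2"
      using c0 s by (simp add: power2_sum)
    also have "\<dots> \<le> (pi / 2 - t + s)\<^sup>2"
      using c c0 s by (intro power_mono) auto
    finally have "dn_amp m t \<le> pi / 2 - t + s"
      unfolding dn_amp_def using that s by (intro real_le_lsqrt) auto
    then show ?thesis
      using dn_amp_pos[OF assms(2), of t] by (intro divide_left_mono mult_pos_pos) auto
  qed
  have "ln ((pi / 2) / s) \<le> ln ((pi / 2 + s) / s)"
    using s pi_gt_zero by (intro ln_mono divide_pos_pos divide_right_mono) auto
  also have "\<dots> = - ln (pi / 2 - pi / 2 + s) - - ln (pi / 2 - 0 + s)"
    using s add_pos_pos[of "pi / 2" s] by (subst ln_div) auto
  also have "\<dots> = integral {0..pi/2} ?h" using h by (simp add: integral_unique)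
  also have "\<dots> \<le> integral {0..pi/2} (\<lambda>t. 1 / dn_amp m t)"
    using h le assms
    by (intro integral_le[OF has_integral_integrable[OF h]] integrable_continuous_real
        continuous_intros) (auto simp: dn_amp_nz)
  also have "\<dots> \<le> complete_K m"
    unfolding complete_K_def using assms dn_amp_pos[OF assms(2)] pi_gt_zero
    by (intro integral_subset_le integrable_continuous_real continuous_intros)
       (auto simp: dn_amp_nz less_imp_le)
  finally show ?thesis unfolding s_def .
qed

text \<open>Here m - 2 is below -1 and E is at most pi. The bound yields both the nonpositive values
  near m = 1 and the upper estimate of the amplitudes.\<close>

lemma flux_modulus_pos_imp:
  assumes "0 \<le> m" "m < 1" "0 < flux_modulus m"
  shows "complete_K m < 3 * pi"
proof -
  have K: "0 < complete_K m" by (rule complete_K_pos[OF assms(1,2)])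
  then have "0 < (m - 2) * complete_K m + 3 * complete_E m"
    using assms(3) unfolding flux_modulus_def by (simp add: zero_less_mult_iff)
  moreover have "(m - 2) * complete_K m \<le> (-1) * complete_K m"
    using K assms by (intro mult_right_mono) auto
  ultimately show ?thesis using complete_E_le_pi[OF assms(1,2)] by linarith
qed

lemma flux_modulus_eventually_nonpos: "\<exists>m. 0 < m \<and> m < 1 \<and> flux_modulus m \<le> 0"
proof -
  \<comment> \<open>In the role of sqrt (1 - m), chosen so that ln (1 / s) is the threshold 3 pi;
    replacing 1 by pi / 2 only increases the logarithm.\<close>
  define s where "s = exp (- 3 * pi)"
  have s: "0 < s" "s < 1" unfolding s_def by auto
  have s2: "0 < s\<^sup>2" "s\<^sup>2 < 1"
    using s by (simp, metis abs_of_pos abs_square_less_1)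
  have "3 * pi = ln (1 / s)"
    unfolding s_def by (simp add: ln_div)
  also have "\<dots> \<le> ln ((pi / 2) / s)"
    using s pi_ge_two by (subst ln_le_cancel_iff) (auto intro!: divide_right_mono simp: field_simps)
  also have "\<dots> \<le> complete_K (1 - s\<^sup>2)"
    using complete_K_ge_ln[of "1 - s\<^sup>2"] s s2 by simp
  finally have "\<not> complete_K (1 - s\<^sup>2) < 3 * pi" by simp
  then have "flux_modulus (1 - s\<^sup>2) \<le> 0"
    using flux_modulus_pos_imp[of "1 - s\<^sup>2"] s2 by fastforce
  with s2 show ?thesis by (intro exI[of _ "1 - s\<^sup>2"]) auto
qed

lemma flux_modulus_attains:
  assumes "0 < y" "y < pi\<^sup>2"
  shows "\<exists>!m. 0 < m \<and> m < 1 \<and> flux_modulus m = y"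
proof -
  obtain m1 where m1: "0 < m1" "m1 < 1" "flux_modulus m1 \<le> 0"
    using flux_modulus_eventually_nonpos by blast
  have "\<exists>m. 0 \<le> m \<and> m \<le> m1 \<and> flux_modulus m = y"
    using m1 assms flux_modulus_isCont by (intro IVT2) (auto simp: flux_modulus_0)
  then obtain m where m: "0 \<le> m" "m \<le> m1" "flux_modulus m = y" by blast
  then have "m \<noteq> 0" using assms flux_modulus_0 by auto
  with m m1 have "0 < m \<and> m < 1 \<and> flux_modulus m = y" by auto
  moreover have "m = m'" if "0 < m" "m < 1" "0 < m'" "m' < 1" "flux_modulus m = flux_modulus m'"
    for m m'
    using flux_modulus_strict_antimono[of m m'] flux_modulus_strict_antimono[of m' m] that
    by (cases m m' rule: linorder_cases) auto
  ultimately show ?thesis by metis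
qed

section \<open>Jacobi's elliptic functions\<close>

text \<open>Legendre's incomplete integral of the second kind; the oriented integral also covers
  negative amplitudes.\<close>

definition incomplete_E :: "real \<Rightarrow> real \<Rightarrow> real" where
  "incomplete_E m \<phi> = (LBINT t=0..ereal \<phi>. dn_amp m t)"

lemma interval_integral_deriv:
  fixes f :: "real \<Rightarrow> real"
  assumes "continuous_on UNIV f"
  shows "((\<lambda>u. LBINT t=0..ereal u. f t) has_real_derivative f x) (at x)"
proof -
  \<comment> \<open>The window contains 0 and has \<open>x\<close> in its interior, so the
    derivative within it is the full one.\<close>
  define r where "r = \<bar>x\<bar> + 1"
  have "((\<lambda>u. LBINT t=ereal 0..ereal u. f t) has_vector_derivative f x) (at x within {-r..r})"
    by (rule interval_integral_FTC2)
       (use assms in \<open>auto simp: r_def intro: continuous_on_subset\<close>)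
  moreover have "at x within {-r..r} = at x"
    by (rule at_within_Icc_at) (auto simp: r_def)
  ultimately show ?thesis
    by (simp add: has_real_derivative_iff_has_vector_derivative zero_ereal_def)
qed

lemma elliptic_F_deriv:
  assumes "m < 1"
  shows "(elliptic_F m has_real_derivative 1 / dn_amp m \<phi>) (at \<phi>)"
proof -
  have "continuous_on UNIV (\<lambda>t. 1 / dn_amp m t)"
    by (intro continuous_intros) (auto simp: dn_amp_nz assms)
  then have "((\<lambda>u. LBINT t=0..ereal u. 1 / dn_amp m t) has_real_derivative 1 / dn_amp m \<phi>) (at \<phi>)"
    by (rule interval_integral_deriv)
  then show ?thesis unfolding elliptic_F_def[abs_def] dn_amp_def .
qed

lemma incomplete_E_deriv: "(incomplete_E m has_real_derivative dn_amp m \<phi>) (at \<phi>)"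
  unfolding incomplete_E_def[abs_def]
  by (intro interval_integral_deriv continuous_intros)

text \<open>The increment \<open>G (t + T) - G t\<close> has derivative zero, hence equals its value
  at 0, the integral over one period.\<close>

lemma primitive_shift:
  fixes G g :: "real \<Rightarrow> real"
  assumes G: "\<And>t. (G has_real_derivative g t) (at t)" and g: "\<And>t. g (t + T) = g t"
    and "0 \<le> T" and I: "(g has_integral I) {0..T}"
  shows "G (t + T) = G t + I"
proof -
  have "((\<lambda>t. G (t + T) - G t) has_real_derivative g (t + T) * (1 + 0) - g t) (at t)" for t
    by (intro DERIV_diff G DERIV_chain2[of G _ "\<lambda>t. t + T"] derivative_intros)
  then have "((\<lambda>t. G (t + T) - G t) has_real_derivative 0) (at t)" for t
    using g by simp
  then have "G (t + T) - G t = G (0 + T) - G 0"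
    using DERIV_isconst_all[of "\<lambda>t. G (t + T) - G t"] by blast
  moreover have "(g has_integral G T - G 0) {0..T}"
    using G \<open>0 \<le> T\<close>
    by (intro fundamental_theorem_of_calculus)
       (auto simp: has_real_derivative_iff_has_vector_derivative[symmetric] intro: DERIV_subset)
  ultimately show ?thesis using has_integral_unique[OF I] by fastforce
qed

lemma elliptic_F_plus_pi:
  assumes "m < 1"
  shows "elliptic_F m (t + pi) = elliptic_F m t + complete_K m"
  by (rule primitive_shift[OF elliptic_F_deriv[OF assms] _ _ has_integral_complete_K[OF assms]])
     (auto simp: dn_amp_plus_pi)

lemma incomplete_E_plus_pi:
  "incomplete_E m (t + pi) = incomplete_E m t + complete_E m"
  by (rule primitive_shift[OF incomplete_E_deriv _ _ has_integral_complete_E])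
     (auto simp: dn_amp_plus_pi)

lemma elliptic_F_0: "elliptic_F m 0 = 0"
  unfolding elliptic_F_def zero_ereal_def by simp

lemma elliptic_F_of_int_pi:
  assumes "m < 1"
  shows "elliptic_F m (of_int n * pi) = of_int n * complete_K m"
proof -
  \<comment> \<open>Removing the linear growth leaves a periodic function, which handles negative
    multiples as well.\<close>
  interpret periodic_fun_simple "\<lambda>t. elliptic_F m t - t * complete_K m / pi" pi
    by standard (simp add: elliptic_F_plus_pi assms field_simps)
  show ?thesis using plus_of_int[of 0 n] by (simp add: elliptic_F_0)
qed

text \<open>The derivative 1 / dn is at least 1. This one estimate gives injectivity, surjectivity
  and a 1-Lipschitz inverse.\<close>

lemma elliptic_F_expanding:
  assumes "0 \<le> m" "m < 1" "x \<le> y"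
  shows "y - x \<le> elliptic_F m y - elliptic_F m x"
proof -
  have "elliptic_F m x - x \<le> elliptic_F m y - y"
  proof (rule DERIV_nonneg_imp_nondecreasing[OF assms(3)])
    fix t
    have "((\<lambda>t. elliptic_F m t - t) has_real_derivative 1 / dn_amp m t - 1) (at t)"
      by (intro derivative_intros elliptic_F_deriv assms)
    moreover have "0 \<le> 1 / dn_amp m t - 1"
      using dn_amp_pos[OF assms(2), of t] dn_amp_le_1[OF assms(1), of t] by simp
    ultimately show "\<exists>d. ((\<lambda>t. elliptic_F m t - t) has_real_derivative d) (at t) \<and> 0 \<le> d"
      by blast
  qed
  then show ?thesis by simp
qed

lemma elliptic_F_inj:
  assumes "0 \<le> m" "m < 1"
  shows "inj (elliptic_F m)"
proof (rule injI)
  fix x y assume "elliptic_F m x = elliptic_F m y"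
  then show "x = y"
    using elliptic_F_expanding[OF assms, of x y] elliptic_F_expanding[OF assms, of y x]
    by (cases x y rule: linorder_cases) auto
qed

lemma elliptic_F_surj:
  assumes "0 \<le> m" "m < 1"
  shows "surj (elliptic_F m)"
proof -
  have "\<exists>x. elliptic_F m x = u" for u
  proof -
  \<comment> \<open>Expansion away from \<open>elliptic_F m 0 = 0\<close> pushes the endpoint values
    beyond u on either side, as the intermediate value theorem requires.\<close>
  have "\<exists>x\<ge>-\<bar>u\<bar>. x \<le> \<bar>u\<bar> \<and> elliptic_F m x = u"
    using elliptic_F_expanding[OF assms, of 0 "\<bar>u\<bar>"]
      elliptic_F_expanding[OF assms, of "-\<bar>u\<bar>" 0]
    by (intro IVT) (auto simp: elliptic_F_0 intro: DERIV_isCont elliptic_F_deriv assms)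
    then show ?thesis by blast
  qed
  then show ?thesis by (metis surj_def)
qed

lemma elliptic_F_jacobi_am:
  assumes "0 \<le> m" "m < 1"
  shows "elliptic_F m (jacobi_am m u) = u"
  unfolding jacobi_am_def by (rule surj_f_inv_f[OF elliptic_F_surj[OF assms]])

lemma jacobi_am_elliptic_F:
  assumes "0 \<le> m" "m < 1"
  shows "jacobi_am m (elliptic_F m \<phi>) = \<phi>"
  unfolding jacobi_am_def by (rule inv_f_f[OF elliptic_F_inj[OF assms]])

lemma jacobi_am_0:
  assumes "0 \<le> m" "m < 1"
  shows "jacobi_am m 0 = 0"
  using jacobi_am_elliptic_F[OF assms, of 0] by (simp add: elliptic_F_0)

lemma jacobi_am_plus_complete_K:
  assumes "0 \<le> m" "m < 1"
  shows "jacobi_am m (u + complete_K m) = jacobi_am m u + pi"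
  using jacobi_am_elliptic_F[OF assms, of "jacobi_am m u + pi"]
  by (simp add: elliptic_F_plus_pi elliptic_F_jacobi_am assms)

lemma jacobi_am_isCont:
  assumes "0 \<le> m" "m < 1"
  shows "isCont (jacobi_am m) u"
proof -
  have "dist (jacobi_am m x) (jacobi_am m y) \<le> 1 * dist x y" for x y
    using elliptic_F_expanding[OF assms, of "jacobi_am m x" "jacobi_am m y"]
      elliptic_F_expanding[OF assms, of "jacobi_am m y" "jacobi_am m x"]
    by (cases "jacobi_am m x \<le> jacobi_am m y")
       (auto simp: elliptic_F_jacobi_am assms dist_real_def)
  then have "1-lipschitz_on UNIV (jacobi_am m)"
    by (intro lipschitz_onI) auto
  then show ?thesis
    using lipschitz_on_continuous_on continuous_on_eq_continuous_at by blast
qed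

lemma jacobi_am_deriv:
  assumes "0 \<le> m" "m < 1"
  shows "(jacobi_am m has_real_derivative dn_amp m (jacobi_am m u)) (at u)"
proof -
  have "(jacobi_am m has_real_derivative inverse (1 / dn_amp m (jacobi_am m u))) (at u)"
    by (rule DERIV_inverse_function[where f = "elliptic_F m" and a = "u - 1" and b = "u + 1"])
       (auto simp: elliptic_F_deriv elliptic_F_jacobi_am jacobi_am_isCont dn_amp_nz assms)
  then show ?thesis by simp
qed

section \<open>The equation for the normal velocity\<close>

text \<open>The second equation of the system with \<open>v = 0\<close> and
  \<open>p = 2 y + c\<close>. Differentiability is asserted explicitly because \<open>deriv\<close>
  has a value even where it fails.\<close>

definition flux_ode :: "real \<Rightarrow> (real \<Rightarrow> real) \<Rightarrow> bool" where
  "flux_ode c y \<longleftrightarrow> (\<forall>x. (y has_real_derivative deriv y x) (at x)) \<and>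
     (\<forall>x. (deriv y has_real_derivative - (y x)\<^sup>2 - 4 * y x - 2 * c) (at x))"

lemma flux_odeI:
  assumes "\<And>x. (y has_real_derivative z x) (at x)"
    and "\<And>x. (z has_real_derivative - (y x)\<^sup>2 - 4 * y x - 2 * c) (at x)"
  shows "flux_ode c y"
proof -
  have "deriv y = z"
    using assms(1) DERIV_imp_deriv by blast
  with assms show ?thesis unfolding flux_ode_def by simp
qed

lemma flux_odeD:
  assumes "flux_ode c y"
  shows "(y has_real_derivative deriv y x) (at x)"
    and "(deriv y has_real_derivative - (y x)\<^sup>2 - 4 * y x - 2 * c) (at x)"
  using assms unfolding flux_ode_def by auto

lemma flux_ode_const: "b\<^sup>2 + 4 * b + 2 * c = 0 \<Longrightarrow> flux_ode c (\<lambda>_. b)"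
  by (rule flux_odeI[where z = "\<lambda>_. 0"]) (auto intro!: derivative_eq_intros)

lemma flux_ode_shift:
  assumes "flux_ode c y"
  shows "flux_ode c (\<lambda>x. y (x - a))" "deriv (\<lambda>x. y (x - a)) x = deriv y (x - a)"
proof -
  have *: "((\<lambda>x. h (x - a)) has_real_derivative h') (at x)"
    if "(h has_real_derivative h') (at (x - a))" for h :: "real \<Rightarrow> real" and h' x
    using DERIV_chain2[of h h' "\<lambda>x. x - a" x 1 UNIV, OF that] DERIV_diff[OF DERIV_ident DERIV_const]
    by fastforce
  show "flux_ode c (\<lambda>x. y (x - a))"
    by (rule flux_odeI[where z = "\<lambda>x. deriv y (x - a)"]; rule *; rule flux_odeD[OF assms])
  show "deriv (\<lambda>x. y (x - a)) x = deriv y (x - a)"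
    by (rule DERIV_imp_deriv, rule *, rule flux_odeD[OF assms])
qed

text \<open>The equation is Newton's, with potential y^3 / 3 + 2 y^2 + 2 c y; the conserved quantity
  is twice the energy.\<close>

lemma flux_ode_energy:
  assumes "flux_ode c y"
  shows "(deriv y x)\<^sup>2 + 2 * ((y x)^3 / 3 + 2 * (y x)\<^sup>2 + 2 * c * y x)
       = (deriv y x')\<^sup>2 + 2 * ((y x')^3 / 3 + 2 * (y x')\<^sup>2 + 2 * c * y x')"
proof -
  let ?e = "\<lambda>x. (deriv y x)\<^sup>2 + 2 * ((y x)^3 / 3 + 2 * (y x)\<^sup>2 + 2 * c * y x)"
  have "(?e has_real_derivative 0) (at x)" for x
    by (auto intro!: derivative_eq_intros flux_odeD[OF assms] simp: algebra_simps power2_eq_square)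
  then show ?thesis using DERIV_isconst_all[of ?e] by blast
qed

text \<open>By the energy identity, functions \<open>A(y) + B(y) y'\<close> with polynomials \<open>A\<close> and \<open>B\<close> are
  closed under differentiation.\<close>

lemma flux_ode_smooth_poly:
  assumes "flux_ode c y"
  shows "smooth (\<lambda>x. poly A (y x) + poly B (y x) * deriv y x)"
proof -
  \<comment> \<open>\<open>P\<close> is the cubic with y'^2 = P(y), its constant term being fixed at
    0, and \<open>q\<close> satisfies y'' = q(y).\<close>
  define P where "P = [:(deriv y 0)\<^sup>2 + 2 * ((y 0)^3 / 3 + 2 * (y 0)\<^sup>2 + 2 * c * y 0),
      - 4 * c, - 4, - 2 / 3:]"
  define q where "q = [:- 2 * c, - 4, - 1:]"
  have P: "poly P (y x) = (deriv y x)\<^sup>2" for x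
    using flux_ode_energy[OF assms, of x 0]
    by (simp add: P_def algebra_simps power2_eq_square power3_eq_cube)
  have q: "(deriv y has_real_derivative poly q (y x)) (at x)" for x
    by (rule DERIV_cong[OF flux_odeD(2)[OF assms]])
       (simp add: q_def algebra_simps power2_eq_square)
  define \<Phi> where "\<Phi> A B = (\<lambda>x. poly A (y x) + poly B (y x) * deriv y x)" for A B
  have D: "(\<Phi> A B has_real_derivative \<Phi> (pderiv B * P + B * q) (pderiv A) x) (at x)" for A B x
  proof -
    have p: "((\<lambda>x. poly C (y x)) has_real_derivative poly (pderiv C) (y x) * deriv y x) (at x)" for C
      by (rule DERIV_chain2[OF poly_DERIV flux_odeD(1)[OF assms]])
    have "(\<Phi> A B has_real_derivative poly (pderiv A) (y x) * deriv y x
        + (poly (pderiv B) (y x) * deriv y x * deriv y x + poly q (y x) * poly B (y x))) (at x)"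
      unfolding \<Phi>_def by (intro DERIV_add DERIV_mult p q)
    then show ?thesis
      unfolding \<Phi>_def by (simp add: P algebra_simps power2_eq_square)
  qed
  have "\<exists>A' B'. (deriv ^^ n) (\<Phi> A B) = \<Phi> A' B'" for n
  proof (induction n)
    case (Suc n)
    then obtain A' B' where "(deriv ^^ n) (\<Phi> A B) = \<Phi> A' B'" by blast
    moreover have "deriv (\<Phi> A' B') = \<Phi> (pderiv B' * P + B' * q) (pderiv A')"
      using D DERIV_imp_deriv by blast
    ultimately show ?case by auto
  qed auto
  then show ?thesis
    unfolding smooth_def \<Phi>_def[symmetric]
    by (metis D real_differentiable_def)
qed

text \<open>The affine form covers the velocity, the pressure and the constants at once.\<close>

lemma flux_ode_smooth:
  assumes "flux_ode c y"
  shows "smooth (\<lambda>x. a * y x + b)"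
  using flux_ode_smooth_poly[OF assms, of "[:b, a:]" 0] by (simp add: add.commute mult.commute)

text \<open>A Gronwall argument. For w = d^2 + e^2 one has |w'| <= (1 + B) w, so exp (- (1 + B) x) w
  cannot increase to the right of x0, nor exp ((1 + B) x) w to the left.\<close>

lemma linear_ode_zero:
  fixes d e g :: "real \<Rightarrow> real"
  assumes d: "\<And>x. (d has_real_derivative e x) (at x)"
    and e: "\<And>x. (e has_real_derivative g x * d x) (at x)"
    and g: "\<And>x. \<bar>g x\<bar> \<le> B" and "d x0 = 0" "e x0 = 0"
  shows "d x = 0"
proof -
  define w where "w x = (d x)\<^sup>2 + (e x)\<^sup>2" for x
  have w: "(w has_real_derivative 2 * (1 + g x) * d x * e x) (at x)" for x
    unfolding w_def[abs_def]
    by (rule derivative_eq_intros d e refl)+ (simp add: algebra_simps)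
  have bound: "\<bar>2 * (1 + g x) * d x * e x\<bar> \<le> (1 + B) * w x" for x
  proof -
    have "\<bar>2 * (1 + g x) * d x * e x\<bar> = \<bar>1 + g x\<bar> * (2 * \<bar>d x\<bar> * \<bar>e x\<bar>)"
      by (simp only: abs_mult)
    also have "\<dots> \<le> (1 + B) * w x"
    proof (intro mult_mono)
      show "2 * \<bar>d x\<bar> * \<bar>e x\<bar> \<le> w x"
        using sum_squares_bound[of "\<bar>d x\<bar>" "\<bar>e x\<bar>"] by (simp add: w_def)
    qed (use g[of x] in auto)
    finally show ?thesis .
  qed
  have w0: "w x0 = 0" and wnn: "0 \<le> w x" for x using assms by (auto simp: w_def)
  have "w x \<le> 0"
  proof (cases "x0 \<le> x")
    case True
    have "exp (- (1 + B) * x) * w x \<le> exp (- (1 + B) * x0) * w x0"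
    proof (rule DERIV_nonpos_imp_nonincreasing[OF True])
      fix t
      have "((\<lambda>x. exp (- (1 + B) * x) * w x) has_real_derivative
          exp (- (1 + B) * t) * (2 * (1 + g t) * d t * e t - (1 + B) * w t)) (at t)"
        by (rule derivative_eq_intros w refl)+ (simp add: algebra_simps)
      moreover have "exp (- (1 + B) * t) * (2 * (1 + g t) * d t * e t - (1 + B) * w t) \<le> 0"
        using bound[of t] by (intro mult_nonneg_nonpos) auto
      ultimately show "\<exists>D. ((\<lambda>x. exp (- (1 + B) * x) * w x) has_real_derivative D) (at t) \<and> D \<le> 0"
        by blast
    qed
    then show ?thesis using w0 by (simp add: mult_le_0_iff)
  next
    case False
    then have "x \<le> x0" by simp
    then have "exp ((1 + B) * x) * w x \<le> exp ((1 + B) * x0) * w x0"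
    proof (rule DERIV_nonneg_imp_nondecreasing)
      fix t
      have "((\<lambda>x. exp ((1 + B) * x) * w x) has_real_derivative
          exp ((1 + B) * t) * (2 * (1 + g t) * d t * e t + (1 + B) * w t)) (at t)"
        by (rule derivative_eq_intros w refl)+ (simp add: algebra_simps)
      moreover have "0 \<le> exp ((1 + B) * t) * (2 * (1 + g t) * d t * e t + (1 + B) * w t)"
        using bound[of t] by (intro mult_nonneg_nonneg) auto
      ultimately show "\<exists>D. ((\<lambda>x. exp ((1 + B) * x) * w x) has_real_derivative D) (at t) \<and> 0 \<le> D"
        by blast
    qed
    then show ?thesis using w0 by (simp add: mult_le_0_iff)
  qed
  then have "(d x)\<^sup>2 + (e x)\<^sup>2 = 0" using wnn[of x] unfolding w_def by linarith
  then show ?thesis by (simp add: sum_power2_eq_zero_iff)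
qed

text \<open>The difference solves a linear equation with coefficient - (y1 + y2 + 4), which is
  bounded because both solutions are.\<close>

lemma flux_ode_unique:
  assumes y1: "flux_ode c y1" and y2: "flux_ode c y2"
    and B1: "\<And>x. \<bar>y1 x\<bar> \<le> B1" and B2: "\<And>x. \<bar>y2 x\<bar> \<le> B2"
    and eq: "y1 x0 = y2 x0" "deriv y1 x0 = deriv y2 x0"
  shows "y1 x = y2 x"
proof -
  have "y1 x - y2 x = 0"
  proof (rule linear_ode_zero[of "\<lambda>x. y1 x - y2 x" "\<lambda>x. deriv y1 x - deriv y2 x"
        "\<lambda>x. - (y1 x + y2 x + 4)" "B1 + B2 + 4" x0])
    show "((\<lambda>x. y1 x - y2 x) has_real_derivative deriv y1 x - deriv y2 x) (at x)" for x
      by (intro DERIV_diff flux_odeD[OF y1] flux_odeD[OF y2])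
    show "((\<lambda>x. deriv y1 x - deriv y2 x) has_real_derivative
        - (y1 x + y2 x + 4) * (y1 x - y2 x)) (at x)" for x
      by (rule DERIV_cong[OF DERIV_diff[OF flux_odeD(2)[OF y1] flux_odeD(2)[OF y2]]])
         (simp add: algebra_simps power2_eq_square)
    show "\<bar>- (y1 x + y2 x + 4)\<bar> \<le> B1 + B2 + 4" for x
      using B1[of x] B2[of x] by linarith
  qed (use eq in auto)
  then show ?thesis by simp
qed

lemma flux_ode_continuous: "flux_ode c y \<Longrightarrow> continuous_on A y"
  by (meson DERIV_isCont continuous_at_imp_continuous_on flux_odeD(1))

text \<open>Integrating the equation over the circle removes y'' by periodicity and the linear term
  by zero flux, leaving c in terms of the integral of y^2.\<close>

lemma flux_ode_pressure:
  assumes y: "flux_ode c y" and per: "periodic_fun_simple y (2 * pi)" and "circle_integral y = 0"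
  shows "c = pressure_const y"
proof -
  interpret periodic_fun_simple y "2 * pi" by (rule per)
  have "deriv y (2 * pi) = deriv y 0"
    using flux_ode_shift(2)[OF y, of "2 * pi" "2 * pi"] minus_1 by simp
  moreover have "((\<lambda>x. - (y x)\<^sup>2 - 4 * y x - 2 * c) has_integral deriv y (2 * pi) - deriv y 0)
      {0..2 * pi}"
    using flux_odeD(2)[OF y]
    by (intro fundamental_theorem_of_calculus)
       (auto simp: has_real_derivative_iff_has_vector_derivative[symmetric] intro: DERIV_subset)
  ultimately have 1: "((\<lambda>x. - (y x)\<^sup>2 - 4 * y x - 2 * c) has_integral 0) {0..2 * pi}" by simp
  have y2: "((\<lambda>x. (y x)\<^sup>2) has_integral circle_integral (\<lambda>x. (y x)\<^sup>2)) {0..2 * pi}"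
    unfolding circle_integral_def
    by (intro integrable_integral integrable_continuous_real continuous_intros
        flux_ode_continuous[OF y])
  have y1: "(y has_integral circle_integral y) {0..2 * pi}"
    unfolding circle_integral_def
    by (intro integrable_integral integrable_continuous_real flux_ode_continuous[OF y])
  have cc: "((\<lambda>x. 2 * c) has_integral 2 * pi * (2 * c)) {0..2 * pi}"
    using has_integral_const_real[of "2 * c" 0 "2 * pi"] by simp
  have "((\<lambda>x. - (y x)\<^sup>2 - 4 * y x - 2 * c) has_integral
      - circle_integral (\<lambda>x. (y x)\<^sup>2) - 4 * circle_integral y - 2 * pi * (2 * c)) {0..2 * pi}"
    by (intro has_integral_diff has_integral_neg has_integral_mult_right y2 y1 cc)
  from has_integral_unique[OF 1 this] show ?thesis
    unfolding pressure_const_def using assms(3) by (simp add: field_simps)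
qed

section \<open>Cnoidal solutions\<close>

text \<open>The coefficients are those for which \<open>a + b cn\<^sup>2(\<kappa> \<theta>)\<close> solves \<open>y'' = - y\<^sup>2 - 4 y - 2 c\<close>.\<close>

definition cnoidal :: "real \<Rightarrow> real \<Rightarrow> real \<Rightarrow> real" where
  "cnoidal m \<kappa> \<theta> = 2 * \<kappa>\<^sup>2 * (1 - 2 * m) - 2 + 6 * \<kappa>\<^sup>2 * m * (jacobi_cn m (\<kappa> * \<theta>))\<^sup>2"

lemma jacobi_am_scaled_deriv:
  assumes "0 \<le> m" "m < 1"
  shows "((\<lambda>\<theta>. jacobi_am m (\<kappa> * \<theta>)) has_real_derivative
    \<kappa> * dn_amp m (jacobi_am m (\<kappa> * \<theta>))) (at \<theta>)"
  by (rule DERIV_cong[OF DERIV_chain2[OF jacobi_am_deriv[OF assms] DERIV_cmult_Id]])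
     (simp add: mult.commute)

text \<open>The amplitude \<phi> satisfies \<phi>' = \<kappa> dn. Once dn^2 and sin^2 are
  eliminated, both sides are polynomials in cos^2 \<phi>, and matching coefficients yields the
  constant.\<close>

lemma cnoidal_flux_ode:
  assumes "0 \<le> m" "m < 1"
  shows "flux_ode (2 - 2 * \<kappa>^4 * (1 - m + m\<^sup>2)) (cnoidal m \<kappa>)"
proof -
  define \<phi> where "\<phi> \<theta> = jacobi_am m (\<kappa> * \<theta>)" for \<theta>
  define D where "D \<theta> = dn_amp m (\<phi> \<theta>)" for \<theta>
  have \<phi>: "(\<phi> has_real_derivative \<kappa> * D \<theta>) (at \<theta>)" for \<theta>
    unfolding \<phi>_def[abs_def] D_def by (rule jacobi_am_scaled_deriv[OF assms])
  have D2: "(D \<theta>)\<^sup>2 = 1 - m * (sin (\<phi> \<theta>))\<^sup>2" and Dnz: "D \<theta> \<noteq> 0" for \<theta>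
    unfolding D_def using assms by (auto simp: dn_amp_square dn_amp_nz)
  have D: "(D has_real_derivative - m * \<kappa> * sin (\<phi> \<theta>) * cos (\<phi> \<theta>)) (at \<theta>)" for \<theta>
    using DERIV_chain2[OF dn_amp_deriv_amplitude[OF assms(2)] \<phi>, of \<theta>] Dnz[of \<theta>]
    unfolding D_def[abs_def] by (simp add: mult_ac)
  note trig = DERIV_chain2[OF DERIV_cos \<phi>] DERIV_chain2[OF DERIV_sin \<phi>]
  have y: "cnoidal m \<kappa> \<theta> = 2 * \<kappa>\<^sup>2 * (1 - 2 * m) - 2 + 6 * \<kappa>\<^sup>2 * m * (cos (\<phi> \<theta>))\<^sup>2" for \<theta>
    by (simp add: cnoidal_def jacobi_cn_def \<phi>_def)
  show ?thesis
  proof (rule flux_odeI[where z = "\<lambda>\<theta>. - 12 * \<kappa>^3 * m * (cos (\<phi> \<theta>) * sin (\<phi> \<theta>) * D \<theta>)"])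
    fix \<theta>
    have "((\<lambda>\<theta>. 2 * \<kappa>\<^sup>2 * (1 - 2 * m) - 2 + 6 * \<kappa>\<^sup>2 * m * (cos (\<phi> \<theta>))\<^sup>2)
        has_real_derivative 0 + 6 * \<kappa>\<^sup>2 * m *
          (of_nat 2 * (- sin (\<phi> \<theta>) * (\<kappa> * D \<theta>) * cos (\<phi> \<theta>) ^ (2 - Suc 0)))) (at \<theta>)"
      by (intro DERIV_add DERIV_const DERIV_cmult DERIV_power trig)
    then show "(cnoidal m \<kappa> has_real_derivative
        - 12 * \<kappa>^3 * m * (cos (\<phi> \<theta>) * sin (\<phi> \<theta>) * D \<theta>)) (at \<theta>)"
      unfolding y[abs_def, symmetric]
      by (rule DERIV_cong) (simp add: power2_eq_square power3_eq_cube)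
  next
    fix \<theta>
    have "((\<lambda>\<theta>. - 12 * \<kappa>^3 * m * (cos (\<phi> \<theta>) * sin (\<phi> \<theta>) * D \<theta>)) has_real_derivative
        - 12 * \<kappa>^3 * m * ((- sin (\<phi> \<theta>) * (\<kappa> * D \<theta>) * sin (\<phi> \<theta>)
            + cos (\<phi> \<theta>) * (\<kappa> * D \<theta>) * cos (\<phi> \<theta>)) * D \<theta>
          + - m * \<kappa> * sin (\<phi> \<theta>) * cos (\<phi> \<theta>) * (cos (\<phi> \<theta>) * sin (\<phi> \<theta>)))) (at \<theta>)"
      by (intro DERIV_cmult DERIV_mult trig D)
    also have "- 12 * \<kappa>^3 * m * ((- sin (\<phi> \<theta>) * (\<kappa> * D \<theta>) * sin (\<phi> \<theta>)
            + cos (\<phi> \<theta>) * (\<kappa> * D \<theta>) * cos (\<phi> \<theta>)) * D \<theta>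
          + - m * \<kappa> * sin (\<phi> \<theta>) * cos (\<phi> \<theta>) * (cos (\<phi> \<theta>) * sin (\<phi> \<theta>)))
       = - 12 * \<kappa>^4 * m * (((cos (\<phi> \<theta>))\<^sup>2 - (sin (\<phi> \<theta>))\<^sup>2) * (D \<theta>)\<^sup>2
          - m * (sin (\<phi> \<theta>))\<^sup>2 * (cos (\<phi> \<theta>))\<^sup>2)"
      by (simp add: algebra_simps power2_eq_square power3_eq_cube power4_eq_xxxx)
    also have "\<dots> = - (cnoidal m \<kappa> \<theta>)\<^sup>2 - 4 * cnoidal m \<kappa> \<theta>
        - 2 * (2 - 2 * \<kappa>^4 * (1 - m + m\<^sup>2))"
      unfolding y D2 sin_squared_eq
      by (simp add: algebra_simps power2_eq_square power4_eq_xxxx)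
    finally show "((\<lambda>\<theta>. - 12 * \<kappa>^3 * m * (cos (\<phi> \<theta>) * sin (\<phi> \<theta>) * D \<theta>)) has_real_derivative
        - (cnoidal m \<kappa> \<theta>)\<^sup>2 - 4 * cnoidal m \<kappa> \<theta>
          - 2 * (2 - 2 * \<kappa>^4 * (1 - m + m\<^sup>2))) (at \<theta>)" .
  qed
qed

lemma cnoidal_bounds:
  assumes "0 \<le> m"
  shows "2 * \<kappa>\<^sup>2 * (1 - 2 * m) - 2 \<le> cnoidal m \<kappa> \<theta>"
    and "cnoidal m \<kappa> \<theta> \<le> 2 * \<kappa>\<^sup>2 * (1 + m) - 2"
proof -
  have "(jacobi_cn m (\<kappa> * \<theta>))\<^sup>2 \<le> 1"
    by (simp add: jacobi_cn_def abs_square_le_1)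
  then have "6 * \<kappa>\<^sup>2 * m * (jacobi_cn m (\<kappa> * \<theta>))\<^sup>2 \<le> 6 * \<kappa>\<^sup>2 * m"
    using assms by (intro mult_left_le) auto
  then show "cnoidal m \<kappa> \<theta> \<le> 2 * \<kappa>\<^sup>2 * (1 + m) - 2"
    unfolding cnoidal_def by (simp add: algebra_simps)
  show "2 * \<kappa>\<^sup>2 * (1 - 2 * m) - 2 \<le> cnoidal m \<kappa> \<theta>"
    unfolding cnoidal_def using assms by simp
qed

lemma cnoidal_at_0:
  assumes "0 \<le> m" "m < 1"
  shows "cnoidal m \<kappa> 0 = 2 * \<kappa>\<^sup>2 * (1 + m) - 2"
  using jacobi_am_0[OF assms] by (simp add: cnoidal_def jacobi_cn_def algebra_simps)

lemma cnoidal_minimum: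
  assumes "0 \<le> m" "m < 1" "\<kappa> \<noteq> 0"
  shows "cnoidal m \<kappa> (elliptic_F m (pi / 2) / \<kappa>) = 2 * \<kappa>\<^sup>2 * (1 - 2 * m) - 2"
  using assms by (simp add: cnoidal_def jacobi_cn_def jacobi_am_elliptic_F)

lemma cnoidal_amplitude:
  assumes "0 \<le> m" "m < 1" "\<kappa> \<noteq> 0"
  shows "amplitude (cnoidal m \<kappa>) = 3 * \<kappa>\<^sup>2 * m"
proof -
  have "Sup (range (cnoidal m \<kappa>)) = 2 * \<kappa>\<^sup>2 * (1 + m) - 2"
    by (rule cSup_eq_maximum)
       (use cnoidal_at_0[OF assms(1,2), of \<kappa>] cnoidal_bounds(2)[OF assms(1)] in \<open>auto, metis rangeI\<close>)
  moreover have "Inf (range (cnoidal m \<kappa>)) = 2 * \<kappa>\<^sup>2 * (1 - 2 * m) - 2"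
    by (rule cInf_eq_minimum)
       (use cnoidal_minimum[OF assms] cnoidal_bounds(1)[OF assms(1)] in \<open>auto, metis rangeI\<close>)
  ultimately show ?thesis unfolding amplitude_def by (simp add: algebra_simps)
qed

lemma cnoidal_not_constant:
  assumes "0 < m" "m < 1" "\<kappa> \<noteq> 0"
  shows "\<not> cnoidal m \<kappa> constant_on UNIV"
proof
  assume "cnoidal m \<kappa> constant_on UNIV"
  then have "cnoidal m \<kappa> 0 = cnoidal m \<kappa> (elliptic_F m (pi / 2) / \<kappa>)"
    unfolding constant_on_def by (metis UNIV_I)
  then show False
    using assms cnoidal_at_0[of m \<kappa>] cnoidal_minimum[of m \<kappa>] by (simp add: algebra_simps)
qed

text \<open>Adding \<open>complete_K m\<close> to the argument raises the amplitude by pi and flips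
  the sign of cn, which its square does not see.\<close>

lemma cnoidal_periodic:
  assumes "0 \<le> m" "m < 1" "\<kappa> * T = complete_K m"
  shows "periodic_fun_simple (cnoidal m \<kappa>) T"
  by standard
     (simp add: cnoidal_def jacobi_cn_def distrib_left assms jacobi_am_plus_complete_K)

text \<open>The value at 0 is the maximum, reached only where cn^2 = 1, that is, where the amplitude
  is a multiple of pi. This serves both the minimal period and the count of oscillations.\<close>

lemma cnoidal_return:
  assumes "0 < m" "m < 1" "\<kappa> \<noteq> 0" "cnoidal m \<kappa> S = cnoidal m \<kappa> 0"
  shows "\<exists>j. \<kappa> * S = of_int j * complete_K m"
proof -
  have "6 * \<kappa>\<^sup>2 * m * (jacobi_cn m (\<kappa> * S))\<^sup>2 = 6 * \<kappa>\<^sup>2 * m * 1"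
    using assms(4) assms(1,2) cnoidal_at_0[of m \<kappa>]
    unfolding cnoidal_def[of m \<kappa> S] by (simp add: algebra_simps)
  then have "(cos (jacobi_am m (\<kappa> * S)))\<^sup>2 = 1"
    using assms unfolding jacobi_cn_def by simp
  then have "sin (jacobi_am m (\<kappa> * S)) = 0"
    by (simp add: cos_squared_eq)
  then obtain j :: int where "jacobi_am m (\<kappa> * S) = of_int j * pi"
    by (auto simp: sin_zero_iff_int2)
  then have "elliptic_F m (jacobi_am m (\<kappa> * S)) = of_int j * complete_K m"
    using elliptic_F_of_int_pi assms by simp
  then show ?thesis using elliptic_F_jacobi_am assms by auto
qed

lemma cnoidal_minimal_period:
  assumes "0 < m" "m < 1" "0 < \<kappa>" "\<kappa> * T = complete_K m"
  shows "minimal_period (cnoidal m \<kappa>) T"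
proof -
  have K: "0 < complete_K m"
    using complete_K_pos[of m] assms by simp
  have "0 < \<kappa> * T" using K assms by simp
  then have T: "0 < T" using assms(3) by (simp add: zero_less_mult_iff)
  have "\<not> periodic_fun_simple (cnoidal m \<kappa>) S" if "0 < S" "S < T" for S
  proof
    assume "periodic_fun_simple (cnoidal m \<kappa>) S"
    then have "cnoidal m \<kappa> (0 + S) = cnoidal m \<kappa> 0"
      by (rule periodic_fun_simple.plus_period)
    then obtain j :: int where j: "\<kappa> * S = of_int j * complete_K m"
      using cnoidal_return[of m \<kappa> S] assms by auto
    have "0 < \<kappa> * S" "\<kappa> * S < complete_K m"
      using that assms(3) by (auto simp: assms(4)[symmetric])
    then have "0 < real_of_int j" "real_of_int j < 1"
      using K unfolding j by (auto simp: zero_less_mult_iff)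
    then show False by simp
  qed
  then show ?thesis
    unfolding minimal_period_def using T cnoidal_periodic[of m \<kappa> T] assms by auto
qed

text \<open>\<open>incomplete_E m (jacobi_am m u)\<close> is a primitive of \<open>dn\<^sup>2\<close>, to which \<open>cn\<^sup>2\<close> is affinely
  related.\<close>

lemma cnoidal_circle_integral:
  assumes "0 \<le> m" "m < 1" and \<kappa>: "\<kappa> = real n * complete_K m / (2 * pi)"
  shows "circle_integral (\<lambda>\<theta>. cnoidal m \<kappa> (\<theta> - a))
    = (real n)\<^sup>2 * flux_modulus m / pi - 4 * pi"
proof -
  \<comment> \<open>From m cn^2 = dn^2 - (1 - m): the constant left when the wave is written as e +
    6 \<kappa>^2 dn^2.\<close>
  define e where "e = 2 * \<kappa>\<^sup>2 * (m - 2) - 2"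
  define W where "W \<theta> = e * \<theta> + 6 * \<kappa> * incomplete_E m (jacobi_am m (\<kappa> * \<theta>))" for \<theta>
  have "(W has_real_derivative e * 1 + 6 * \<kappa> * (dn_amp m (jacobi_am m (\<kappa> * \<theta>)) *
      (\<kappa> * dn_amp m (jacobi_am m (\<kappa> * \<theta>))))) (at \<theta>)" for \<theta>
    unfolding W_def[abs_def]
    by (intro DERIV_add DERIV_cmult DERIV_ident DERIV_chain2[OF incomplete_E_deriv]
        jacobi_am_scaled_deriv assms)
  moreover have "e * 1 + 6 * \<kappa> * (dn_amp m (jacobi_am m (\<kappa> * \<theta>)) *
      (\<kappa> * dn_amp m (jacobi_am m (\<kappa> * \<theta>)))) = cnoidal m \<kappa> \<theta>" for \<theta>
  proof -
    have "e * 1 + 6 * \<kappa> * (dn_amp m (jacobi_am m (\<kappa> * \<theta>)) *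
      (\<kappa> * dn_amp m (jacobi_am m (\<kappa> * \<theta>)))) = e + 6 * \<kappa>\<^sup>2 * (dn_amp m (jacobi_am m (\<kappa> * \<theta>)))\<^sup>2"
      by (simp add: power2_eq_square)
    also have "\<dots> = cnoidal m \<kappa> \<theta>"
      unfolding dn_amp_square[OF assms(2)] cnoidal_def jacobi_cn_def e_def cos_squared_eq
      by (simp add: algebra_simps)
    finally show ?thesis .
  qed
  ultimately have W: "(W has_real_derivative cnoidal m \<kappa> \<theta>) (at \<theta>)" for \<theta>
    by simp
  have "((\<lambda>\<theta>. W (\<theta> - a)) has_real_derivative cnoidal m \<kappa> (\<theta> - a)) (at \<theta>)" for \<theta>
    using DERIV_chain2[OF W, of "\<lambda>\<theta>. \<theta> - a" 1 \<theta> UNIV] DERIV_diff[OF DERIV_ident DERIV_const]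
    by fastforce
  then have "((\<lambda>\<theta>. cnoidal m \<kappa> (\<theta> - a)) has_integral W (2 * pi - a) - W (0 - a)) {0..2 * pi}"
    by (intro fundamental_theorem_of_calculus)
       (auto simp: has_real_derivative_iff_has_vector_derivative[symmetric] intro: DERIV_subset)
  then have 1: "circle_integral (\<lambda>\<theta>. cnoidal m \<kappa> (\<theta> - a)) = W (- a + 2 * pi) - W (- a)"
    unfolding circle_integral_def by (simp add: integral_unique)
  have am: "jacobi_am m (u + real j * complete_K m) = jacobi_am m u + real j * pi" for u j
  proof (induction j)
    case (Suc j)
    have "jacobi_am m (u + real (Suc j) * complete_K m)
        = jacobi_am m ((u + real j * complete_K m) + complete_K m)"
      by (simp add: algebra_simps)
    then show ?case
      unfolding jacobi_am_plus_complete_K[OF assms(1,2)] Suc by (simp add: algebra_simps)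
  qed simp
  have iE: "incomplete_E m (t + real j * pi) = incomplete_E m t + real j * complete_E m" for t j
  proof (induction j)
    case (Suc j)
    have "incomplete_E m (t + real (Suc j) * pi) = incomplete_E m ((t + real j * pi) + pi)"
      by (simp add: algebra_simps)
    then show ?case
      unfolding incomplete_E_plus_pi Suc by (simp add: algebra_simps)
  qed simp
  \<comment> \<open>One turn adds n pi to the amplitude and hence n \<open>complete_E m\<close> to
    the integral of the second kind.\<close>
  have "\<kappa> * (- a + 2 * pi) = \<kappa> * (- a) + real n * complete_K m"
    unfolding \<kappa> by (simp add: field_simps)
  then have "W (- a + 2 * pi) - W (- a) = e * (2 * pi) + 6 * \<kappa> * (real n * complete_E m)"
    unfolding W_def by (simp only: am iE) (simp add: algebra_simps)
  also have "\<dots> = (real n)\<^sup>2 * flux_modulus m / pi - 4 * pi"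
    unfolding e_def \<kappa> flux_modulus_def by (simp add: field_simps power2_eq_square)
  finally show ?thesis unfolding 1 .
qed

section \<open>Periodic solutions\<close>

lemma periodic_continuous_attains_max:
  fixes f :: "real \<Rightarrow> real"
  assumes "continuous_on UNIV f" "periodic_fun_simple f T" "0 < T"
  shows "\<exists>x0. \<forall>x. f x \<le> f x0"
proof -
  interpret periodic_fun_simple f T by (rule assms)
  have "\<exists>x0\<in>{0..T}. \<forall>x\<in>{0..T}. f x \<le> f x0"
    using assms by (intro continuous_attains_sup) (auto intro: continuous_on_subset)
  then obtain x0 where x0: "\<And>x. x \<in> {0..T} \<Longrightarrow> f x \<le> f x0" by blast
  have "f x \<le> f x0" for x
  proof -
    have "x - of_int \<lfloor>x / T\<rfloor> * T = frac (x / T) * T"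
      using assms(3) by (simp add: frac_def field_simps)
    moreover have "frac (x / T) * T \<in> {0..T}"
      using assms(3) frac_lt_1[of "x / T"] by (auto intro!: mult_left_le_one_le)
    ultimately show ?thesis using x0 minus_of_int[of x "\<lfloor>x / T\<rfloor>"] by metis
  qed
  then show ?thesis by blast
qed

text \<open>For a <= b and n large, f a <= f b <= f (a + n T) = f a.\<close>

lemma periodic_mono_imp_constant:
  fixes f :: "real \<Rightarrow> real"
  assumes "mono f" "periodic_fun_simple f T" "0 < T"
  shows "f x = f y"
proof -
  interpret periodic_fun_simple f T by (rule assms)
  have "f a = f b" if "a \<le> b" for a b
  proof (rule antisym)
    obtain n :: nat where "b - a < of_nat n * T"
      using reals_Archimedean3[OF assms(3)] by blast
    then have "f b \<le> f (a + of_nat n * T)"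
      by (intro monoD[OF assms(1)]) auto
    then show "f b \<le> f a" by (simp add: plus_of_nat)
  qed (rule monoD[OF assms(1) that])
  then show ?thesis by (metis linear)
qed

text \<open>By energy, f'^2 is a cubic in f with roots M, \<mu> and -(6 + M + \<mu>). The third root
  must lie strictly below \<mu>; then a cnoidal wave with the same extrema solves the same equation,
  and uniqueness at a maximum identifies it with f.\<close>

lemma periodic_flux_ode_cnoidal:
  assumes f: "flux_ode c f" and per: "periodic_fun_simple f T" "0 < T"
    and nc: "\<not> f constant_on UNIV"
  shows "\<exists>m \<kappa> a. 0 < m \<and> m < 1 \<and> 0 < \<kappa> \<and> (\<forall>x. f x = cnoidal m \<kappa> (x - a))"
proof -
  have cont: "continuous_on A f" for A by (rule flux_ode_continuous[OF f])
  obtain x1 where x1: "\<And>x. f x \<le> f x1"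
    using periodic_continuous_attains_max[OF cont per] by blast
  have "periodic_fun_simple (\<lambda>x. - f x) T"
    using per(1) by (simp add: periodic_fun_simple_def)
  then obtain x2 where x2: "\<And>x. f x2 \<le> f x"
    using periodic_continuous_attains_max[of "\<lambda>x. - f x" T] per(2) cont
      continuous_on_minus[OF cont] by auto
  define M \<mu> where "M = f x1" and "\<mu> = f x2"
  have "\<mu> \<noteq> M"
  proof
    assume "\<mu> = M"
    then have "f x = M" for x using x1[of x] x2[of x] unfolding M_def \<mu>_def by linarith
    then show False using nc unfolding constant_on_def by blast
  qed
  then have \<mu>M: "\<mu> < M" using x1[of x2] unfolding M_def \<mu>_def by linarith
  have d1: "deriv f x1 = 0"
    using x1 by (intro DERIV_local_max[OF flux_odeD(1)[OF f], of 1]) auto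
  have d2: "deriv f x2 = 0"
    using x2 by (intro DERIV_local_min[OF flux_odeD(1)[OF f], of 1]) auto
  \<comment> \<open>The energies at the two extrema agree; dividing by the nonzero factor M - \<mu>
    determines c.\<close>
  have "(M - \<mu>) * (M\<^sup>2 + M * \<mu> + \<mu>\<^sup>2 + 6 * (M + \<mu>) + 6 * c) = 0"
    using flux_ode_energy[OF f, of x1 x2] d1 d2 unfolding M_def[symmetric] \<mu>_def[symmetric]
    by (simp add: algebra_simps power2_eq_square power3_eq_cube)
  then have c: "c = - (M\<^sup>2 + M * \<mu> + \<mu>\<^sup>2 + 6 * (M + \<mu>)) / 6"
    using \<mu>M by simp
  have energy: "(deriv f x)\<^sup>2 = 2 / 3 * ((M - f x) * (f x - \<mu>) * (f x + 6 + M + \<mu>))" for x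
    using flux_ode_energy[OF f, of x x1] d1 unfolding M_def[symmetric] c
    by (simp add: field_simps power2_eq_square power3_eq_cube)
  have ge: "0 \<le> 2 * \<mu> + M + 6"
  proof (rule ccontr)
    assume neg: "\<not> 0 \<le> 2 * \<mu> + M + 6"
    \<comment> \<open>Were the third root above \<mu>, the cubic would be negative just above \<mu>.
      The midpoint between \<mu> and the smaller of the other roots is such a value, and f takes
      it.\<close>
    define t where "t = (\<mu> + min M (- (6 + M + \<mu>))) / 2"
    have t: "\<mu> < t" "t < M" "t + 6 + M + \<mu> < 0"
      using neg \<mu>M unfolding t_def by (auto simp: min_def field_simps)
    have "connected (range f)" by (intro connected_continuous_image cont connected_UNIV)
    then have "t \<in> range f"
      using t unfolding M_def \<mu>_def by (meson connectedD_interval less_imp_le rangeI)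
    then obtain x where x: "f x = t" by blast
    have "(M - t) * (t - \<mu>) * (t + 6 + M + \<mu>) < 0"
      using t by (intro mult_pos_neg mult_pos_pos) auto
    then have "(deriv f x)\<^sup>2 < 0" unfolding energy x by simp
    then show False using zero_le_power2[of "deriv f x"] by linarith
  qed
  have bd: "\<bar>f x\<bar> \<le> \<bar>M\<bar> + \<bar>\<mu>\<bar>" for x
    using x1[of x] x2[of x] unfolding M_def \<mu>_def by linarith
  \<comment> \<open>At a double root \<mu> is an equilibrium, the limit case of a solitary wave;
    uniqueness at the minimum would make f constant.\<close>
  have gt: "0 < 2 * \<mu> + M + 6"
  proof (rule ccontr)
    assume "\<not> 0 < 2 * \<mu> + M + 6"
    then have M: "M = - 6 - 2 * \<mu>" using ge by linarith
    have "\<mu>\<^sup>2 + 4 * \<mu> + 2 * c = 0"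
      unfolding c M by (simp add: field_simps power2_eq_square)
    then have const: "flux_ode c (\<lambda>_. \<mu>)" by (rule flux_ode_const)
    have "f x = \<mu>" for x
      using flux_ode_unique[OF f const bd order_refl, of x2 x] d2 by (simp add: \<mu>_def)
    then show False using nc unfolding constant_on_def by blast
  qed
  \<comment> \<open>Matching the extrema of the wave with M and \<mu> means 6 \<kappa>^2 = 2 M +
    \<mu> + 6 and 6 \<kappa>^2 m = M - \<mu>.\<close>
  define s where "s = 2 * M + \<mu> + 6"
  define \<kappa> m where "\<kappa> = sqrt (s / 6)" and "m = (M - \<mu>) / s"
  have s: "0 < s" "M - \<mu> < s" using gt \<mu>M unfolding s_def by linarith+
  have \<kappa>2: "\<kappa>\<^sup>2 = s / 6" and \<kappa>: "0 < \<kappa>"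
    using s by (auto simp: \<kappa>_def)
  have m: "0 < m" "m < 1" using s \<mu>M by (auto simp: m_def)
  have \<kappa>m: "\<kappa>\<^sup>2 * m = (M - \<mu>) / 6" using s by (simp add: \<kappa>2 m_def)
  have "2 * \<kappa>\<^sup>2 * (1 + m) - 2 = 2 * \<kappa>\<^sup>2 + 2 * (\<kappa>\<^sup>2 * m) - 2"
    by (simp add: algebra_simps)
  also have "\<dots> = M" unfolding \<kappa>m unfolding \<kappa>2 s_def by (simp add: field_simps)
  finally have max: "2 * \<kappa>\<^sup>2 * (1 + m) - 2 = M" .
  have "2 - 2 * \<kappa>^4 * (1 - m + m\<^sup>2) = 2 - 2 * ((\<kappa>\<^sup>2)\<^sup>2 - \<kappa>\<^sup>2 * (\<kappa>\<^sup>2 * m) + (\<kappa>\<^sup>2 * m)\<^sup>2)"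
    by (simp add: algebra_simps power2_eq_square power4_eq_xxxx)
  also have "\<dots> = c"
    unfolding \<kappa>m unfolding \<kappa>2 s_def c by (simp add: field_simps power2_eq_square)
  finally have h: "flux_ode c (cnoidal m \<kappa>)"
    using cnoidal_flux_ode[of m \<kappa>] m by simp
  have h0: "cnoidal m \<kappa> 0 = M" using cnoidal_at_0[of m \<kappa>] m max by simp
  have dh0: "deriv (cnoidal m \<kappa>) 0 = 0"
    using cnoidal_bounds(2)[of m \<kappa>] m h0 max
    by (intro DERIV_local_max[OF flux_odeD(1)[OF h], of 1]) auto
  have bh: "\<bar>cnoidal m \<kappa> x\<bar> \<le> \<bar>2 * \<kappa>\<^sup>2 * (1 - 2 * m) - 2\<bar> + \<bar>2 * \<kappa>\<^sup>2 * (1 + m) - 2\<bar>" for x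
    using cnoidal_bounds[of m \<kappa> x] m by linarith
  have "f x = cnoidal m \<kappa> (x - x1)" for x
  proof (rule flux_ode_unique[OF f flux_ode_shift(1)[OF h] bd bh])
    show "f x1 = cnoidal m \<kappa> (x1 - x1)" using h0 by (simp add: M_def)
    show "deriv f x1 = deriv (\<lambda>x. cnoidal m \<kappa> (x - x1)) x1"
      unfolding flux_ode_shift(2)[OF h] using d1 dh0 by simp
  qed
  then show ?thesis using m \<kappa> by blast
qed

section \<open>The family of zero flux solutions\<close>

definition flux_parameter :: "nat \<Rightarrow> real" where
  "flux_parameter k = (THE m. 0 < m \<and> m < 1 \<and> flux_modulus m = 4 * pi\<^sup>2 / (real k)\<^sup>2)"

text \<open>The frequency fits exactly k periods of cn^2 into the circle.\<close>

definition flux_solution :: "nat \<Rightarrow> real \<Rightarrow> real" where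
  "flux_solution k = cnoidal (flux_parameter k)
     (real k * complete_K (flux_parameter k) / (2 * pi))"

text \<open>For k = 2 the target would be pi^2, the value at m = 0, where the wave degenerates to a
  constant; from k = 3 on it lies strictly below.\<close>

lemma flux_parameter_unique:
  assumes "3 \<le> k"
  shows "\<exists>!m. 0 < m \<and> m < 1 \<and> flux_modulus m = 4 * pi\<^sup>2 / (real k)\<^sup>2"
proof (rule flux_modulus_attains)
  have "2\<^sup>2 < (real k)\<^sup>2" using assms by (intro power_strict_mono) auto
  then show "4 * pi\<^sup>2 / (real k)\<^sup>2 < pi\<^sup>2"
    using assms by (simp add: field_simps)
qed (use assms in simp)

lemma flux_parameter:
  assumes "3 \<le> k"
  shows "0 < flux_parameter k" "flux_parameter k < 1"
    "flux_modulus (flux_parameter k) = 4 * pi\<^sup>2 / (real k)\<^sup>2"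
  using theI'[OF flux_parameter_unique[OF assms]] unfolding flux_parameter_def by auto

lemma flux_parameter_eqI:
  assumes "3 \<le> k" "0 < m" "m < 1" "flux_modulus m = 4 * pi\<^sup>2 / (real k)\<^sup>2"
  shows "flux_parameter k = m"
  using flux_parameter_unique[OF assms(1)] flux_parameter[OF assms(1)] assms(2-4) by blast

lemma flux_solution_frequency_pos:
  assumes "3 \<le> k"
  shows "0 < real k * complete_K (flux_parameter k) / (2 * pi)"
  using complete_K_pos[of "flux_parameter k"] flux_parameter[OF assms] assms
  by (intro divide_pos_pos mult_pos_pos) auto

lemma flux_solution_ode: "3 \<le> k \<Longrightarrow> \<exists>c. flux_ode c (flux_solution k)"
  unfolding flux_solution_def using cnoidal_flux_ode flux_parameter[of k] by (meson less_imp_le)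

lemma flux_solution_minimal_period:
  assumes "3 \<le> k"
  shows "minimal_period (flux_solution k) (2 * pi / real k)"
  unfolding flux_solution_def
  by (rule cnoidal_minimal_period)
     (use flux_parameter[OF assms] flux_solution_frequency_pos[OF assms] assms in auto)

lemma flux_solution_periodic:
  assumes "3 \<le> k"
  shows "periodic_fun_simple (flux_solution k) (2 * pi)"
proof -
  interpret periodic_fun_simple "flux_solution k" "2 * pi / real k"
    using flux_solution_minimal_period[OF assms] by (simp add: minimal_period_def)
  show ?thesis
    by standard (use plus_of_nat[of _ k] assms in simp)
qed

lemma flux_solution_circle_integral:
  assumes "3 \<le> k"
  shows "circle_integral (\<lambda>\<theta>. flux_solution k (\<theta> - a)) = 0"
  unfolding flux_solution_def
  using cnoidal_circle_integral[of "flux_parameter k" _ k a] flux_parameter[OF assms] assms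
  by (simp add: power2_eq_square)

lemma flux_solution_pressure:
  assumes "3 \<le> k" "flux_ode c (flux_solution k)"
  shows "c = pressure_const (flux_solution k)"
  using flux_ode_pressure[OF assms(2) flux_solution_periodic[OF assms(1)]]
    flux_solution_circle_integral[OF assms(1), of 0] by simp

text \<open>The amplitude is 3/4 m (K / pi)^2 k^2. As \<open>flux_modulus\<close> decreases, m is
  smallest for k = 3, and K stays between pi and 3 pi.\<close>

lemma flux_solution_amplitude_bounds:
  assumes "3 \<le> k"
  shows "3 / 4 * flux_parameter 3 * (real k)\<^sup>2 \<le> amplitude (flux_solution k)"
    and "amplitude (flux_solution k) \<le> 27 / 4 * (real k)\<^sup>2"
proof -
  define m K where "m = flux_parameter k" and "K = complete_K m"
  note m = flux_parameter[OF assms, folded m_def]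
  have m3: "flux_parameter 3 \<le> m"
  proof (rule ccontr)
    assume "\<not> flux_parameter 3 \<le> m"
    then have "flux_modulus (flux_parameter 3) < flux_modulus m"
      using m flux_parameter[of 3] by (intro flux_modulus_strict_antimono) auto
    moreover have "4 * pi\<^sup>2 / (real k)\<^sup>2 \<le> 4 * pi\<^sup>2 / (real 3)\<^sup>2"
      using assms by (intro divide_left_mono power_mono mult_pos_pos) auto
    ultimately show False using m flux_parameter[of 3] by simp
  qed
  have K: "pi \<le> K" "K \<le> 3 * pi"
    unfolding K_def using m assms by (auto intro!: complete_K_ge_pi less_imp_le[OF flux_modulus_pos_imp])
  then have K2: "pi\<^sup>2 \<le> K\<^sup>2" "K\<^sup>2 \<le> (3 * pi)\<^sup>2"
    using power_mono[of pi K 2] power_mono[of K "3 * pi" 2] pi_ge_zero order_trans by blast+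
  have "real k * K / (2 * pi) \<noteq> 0"
    using flux_solution_frequency_pos[OF assms] unfolding K_def m_def by linarith
  then have "amplitude (flux_solution k) = 3 * (real k * K / (2 * pi))\<^sup>2 * m"
    unfolding flux_solution_def m_def[symmetric] K_def[symmetric]
    using m by (intro cnoidal_amplitude) auto
  then have amp: "amplitude (flux_solution k) = 3 / 4 * (m * (K\<^sup>2 / pi\<^sup>2)) * (real k)\<^sup>2"
    by (simp add: power_mult_distrib power_divide)
  have "flux_parameter 3 * 1 \<le> m * (K\<^sup>2 / pi\<^sup>2)"
    using m3 m K2 by (intro mult_mono) auto
  then show "3 / 4 * flux_parameter 3 * (real k)\<^sup>2 \<le> amplitude (flux_solution k)"
    unfolding amp by (intro mult_right_mono) auto
  have "m * (K\<^sup>2 / pi\<^sup>2) \<le> 1 * 9"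
    using m K2 by (intro mult_mono) (auto simp: field_simps power_mult_distrib)
  then show "amplitude (flux_solution k) \<le> 27 / 4 * (real k)\<^sup>2"
    unfolding amp by (intro mult_right_mono) auto
qed

lemma flux_solution_amplitude:
  "(\<lambda>k. amplitude (flux_solution k)) \<in> \<Theta>(\<lambda>k. (real k)\<^sup>2)"
proof (rule bigthetaI')
  have "0 < flux_parameter 3" using flux_parameter(1)[of 3] by simp
  then show "0 < 3 / 4 * flux_parameter 3" by simp
  show "\<forall>\<^sub>F k in at_top. 3 / 4 * flux_parameter 3 * norm ((real k)\<^sup>2) \<le> norm (amplitude (flux_solution k))
      \<and> norm (amplitude (flux_solution k)) \<le> 27 / 4 * norm ((real k)\<^sup>2)"
  proof (rule eventually_at_top_linorderI[of 3])
    fix k :: nat assume k: "3 \<le> k"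
    have "0 \<le> 3 / 4 * flux_parameter 3 * (real k)\<^sup>2"
      using \<open>0 < flux_parameter 3\<close> by simp
    then show "3 / 4 * flux_parameter 3 * norm ((real k)\<^sup>2) \<le> norm (amplitude (flux_solution k))
      \<and> norm (amplitude (flux_solution k)) \<le> 27 / 4 * norm ((real k)\<^sup>2)"
      using flux_solution_amplitude_bounds[OF k] by simp
  qed
qed simp

text \<open>A nonconstant periodic solution with zero mean returns to its maximum after \<open>2 \<pi>\<close>, which
  makes the number \<open>n\<close> of oscillations an integer; \<open>flux_modulus m < \<pi>\<^sup>2\<close> then forces
  \<open>n\<^sup>2 > 4\<close>.\<close>

lemma zero_flux_solution:
  assumes f: "flux_ode c f" and per: "periodic_fun_simple f (2 * pi)"
    and nc: "\<not> f constant_on UNIV" and zero: "circle_integral f = 0"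
  shows "\<exists>k\<ge>3. \<exists>a. \<forall>x. f x = flux_solution k (x - a)"
proof -
  obtain m \<kappa> a where m: "0 < m" "m < 1" and \<kappa>: "0 < \<kappa>"
    and fh: "\<And>x. f x = cnoidal m \<kappa> (x - a)"
    using periodic_flux_ode_cnoidal[OF f per _ nc] by auto
  have K: "0 < complete_K m"
    using complete_K_pos[of m] m by simp
  have "f (a + 2 * pi) = f a" by (rule periodic_fun_simple.plus_period[OF per])
  then have "cnoidal m \<kappa> (2 * pi) = cnoidal m \<kappa> 0" by (simp add: fh)
  then obtain j :: int where j: "\<kappa> * (2 * pi) = of_int j * complete_K m"
    using cnoidal_return[of m \<kappa>] m \<kappa> by auto
  have "0 < \<kappa> * (2 * pi)" using \<kappa> by simp
  then have "0 < j" unfolding j using K by (simp add: zero_less_mult_iff)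
  then obtain n :: nat where n: "j = int n" "0 < n"
    by (metis of_nat_0_less_iff zero_less_imp_eq_int)
  have \<kappa>n: "\<kappa> = real n * complete_K m / (2 * pi)"
    using j n by (simp add: field_simps)
  have "(real n)\<^sup>2 * flux_modulus m / pi - 4 * pi = 0"
    using cnoidal_circle_integral[of m \<kappa> n a] m \<kappa>n zero fh[abs_def] by simp
  then have G: "(real n)\<^sup>2 * flux_modulus m = 4 * pi\<^sup>2"
    by (simp add: field_simps power2_eq_square)
  have "flux_modulus m < pi\<^sup>2"
    using flux_modulus_strict_antimono[of 0 m] m flux_modulus_0 by simp
  then have "4 * pi\<^sup>2 < (real n)\<^sup>2 * pi\<^sup>2"
    unfolding G[symmetric] using n by simp
  then have "2\<^sup>2 < (real n)\<^sup>2" by simp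
  then have "2 < real n" by (rule power_less_imp_less_base) simp
  then have n3: "3 \<le> n" by simp
  have "flux_parameter n = m"
    by (rule flux_parameter_eqI[OF n3 m]) (use G n in \<open>simp add: field_simps\<close>)
  then have "f x = flux_solution n (x - a)" for x
    unfolding flux_solution_def fh \<kappa>n by simp
  then show ?thesis using n3 by blast
qed

section \<open>The system on the circle\<close>

lemma smooth_const: "smooth (\<lambda>_. b)"
  using flux_ode_smooth[OF flux_ode_const[of 0 0], of 0 b] by simp

lemma smooth_deriv:
  assumes "smooth g"
  shows "(g has_real_derivative deriv g x) (at x)"
    and "(deriv g has_real_derivative deriv (deriv g) x) (at x)"
proof -
  have "(deriv ^^ 0) g differentiable at x" "(deriv ^^ 1) g differentiable at x"
    using assms unfolding smooth_def by blast+
  then show "(g has_real_derivative deriv g x) (at x)"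
    "(deriv g has_real_derivative deriv (deriv g) x) (at x)"
    by (simp_all add: DERIV_deriv_iff_real_differentiable)
qed

text \<open>Smoothness makes the derivatives genuine, so the first and third equations give
  constants and the pressure can be eliminated from the second.\<close>

lemma circle_NS_reduced:
  assumes "smooth f" "smooth v" "smooth p" "circle_NS f v p"
  obtains b c where "v = (\<lambda>_. b)" "p = (\<lambda>\<theta>. 2 * f \<theta> + c)"
    "\<And>\<theta>. deriv (deriv f) \<theta> = b * deriv f \<theta> - (f \<theta>)\<^sup>2 - 4 * f \<theta> - (b\<^sup>2 + 2 * c)"
proof -
  have NS: "deriv (\<lambda>t. p t - 2 * f t) \<theta> = 0" "deriv v \<theta> = 0"
    "- deriv (deriv f) \<theta> + v \<theta> * deriv f \<theta> - (f \<theta>)\<^sup>2 - \<bar>v \<theta>\<bar>\<^sup>2 - 2 * p \<theta> = 0" for \<theta>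
    using assms(4) unfolding circle_NS_def by auto
  have "(v has_real_derivative 0) (at \<theta>)" for \<theta>
    using smooth_deriv(1)[OF assms(2), of \<theta>] NS(2) by simp
  then have v: "v \<theta> = v 0" for \<theta> using DERIV_isconst_all by blast
  have "((\<lambda>t. p t - 2 * f t) has_real_derivative 0) (at \<theta>)" for \<theta>
  proof -
    have "((\<lambda>t. p t - 2 * f t) has_real_derivative deriv p \<theta> - 2 * deriv f \<theta>) (at \<theta>)"
      by (intro DERIV_diff DERIV_cmult smooth_deriv assms)
    moreover from DERIV_imp_deriv[OF this] have "deriv p \<theta> - 2 * deriv f \<theta> = 0"
      using NS(1) by simp
    ultimately show ?thesis by simp
  qed
  then have p: "p \<theta> - 2 * f \<theta> = p 0 - 2 * f 0" for \<theta>
    using DERIV_isconst_all[of "\<lambda>t. p t - 2 * f t"] by blast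
  show thesis
  proof (rule that[of "v 0" "p 0 - 2 * f 0"])
    show "v = (\<lambda>_. v 0)" using v by auto
    show pp: "p = (\<lambda>\<theta>. 2 * f \<theta> + (p 0 - 2 * f 0))"
      using p by (auto simp: fun_eq_iff algebra_simps)
    show "deriv (deriv f) \<theta> = v 0 * deriv f \<theta> - (f \<theta>)\<^sup>2 - 4 * f \<theta>
        - ((v 0)\<^sup>2 + 2 * (p 0 - 2 * f 0))" for \<theta>
      using NS(3)[of \<theta>] p[of \<theta>] v[of \<theta>] by (simp add: algebra_simps)
  qed
qed

text \<open>Without the friction term \<open>b f'\<close> the energy would be conserved; with it, the energy is
  monotone along a periodic orbit.\<close>

lemma tangential_velocity_zero:
  assumes f: "\<And>x. (f has_real_derivative f' x) (at x)"
    and f': "\<And>x. (f' has_real_derivative b * f' x - (f x)\<^sup>2 - 4 * f x - c) (at x)"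
    and per: "periodic_fun_simple f T" "0 < T" and nc: "\<not> f constant_on UNIV"
  shows "b = 0"
proof (rule ccontr)
  assume b: "b \<noteq> 0"
  interpret periodic_fun_simple f T by (rule per)
  \<comment> \<open>The factor b makes the derivative of the energy the square (b f')^2, whatever
    the sign of b.\<close>
  define w where "w x = b * ((f' x)\<^sup>2 / 2 + (f x)^3 / 3 + 2 * (f x)\<^sup>2 + c * f x)" for x
  have w: "(w has_real_derivative (b * f' x)\<^sup>2) (at x)" for x
    unfolding w_def[abs_def]
    by (auto intro!: derivative_eq_intros f f' simp: field_simps power2_eq_square)
  have "mono w"
    by (rule monoI, rule DERIV_nonneg_imp_nondecreasing) (use w in \<open>auto intro!: exI\<close>)
  moreover have "periodic_fun_simple w T"
  proof
    fix x
    have "((\<lambda>x. f (x + T)) has_real_derivative f' (x + T)) (at x)"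
      using f[of "x + T"] by (simp add: DERIV_shift)
    then have "f' (x + T) = f' x"
      using DERIV_unique[OF f] by (simp add: plus_period)
    then show "w (x + T) = w x" by (simp add: w_def plus_period)
  qed
  ultimately have "w x = w 0" for x
    using periodic_mono_imp_constant per(2) by blast
  then have "w = (\<lambda>_. w 0)" by auto
  then have "(b * f' x)\<^sup>2 = 0" for x
    using DERIV_unique[OF w] DERIV_const by metis
  then have "(f has_real_derivative 0) (at x)" for x
    using f[of x] b by simp
  then have "f x = f 0" for x using DERIV_isconst_all by blast
  then show False using nc unfolding constant_on_def by blast
qed

theorem theorem2:
  shows "\<exists>F :: nat \<Rightarrow> real \<Rightarrow> real.
    (\<forall>k\<ge>3. smooth_circle_fun (F k) \<and> \<not> (F k) constant_on UNIV \<and>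
            minimal_period (F k) (2 * pi / real k)) \<and>
    (\<forall>f v p :: real \<Rightarrow> real.
       (smooth_circle_fun f \<and> smooth_circle_fun v \<and> smooth_circle_fun p \<and>
        circle_NS f v p \<and> circle_integral f = 0) \<longleftrightarrow>
       ((\<forall>\<theta>. f \<theta> = 0) \<and> (\<exists>c. \<forall>\<theta>. v \<theta> = c) \<and> (\<forall>\<theta>. p \<theta> = - \<bar>v \<theta>\<bar>\<^sup>2 / 2)) \<or>
       (\<exists>k\<ge>3. \<exists>\<theta>\<^sub>0.
          (\<forall>\<theta>. f \<theta> = F k (\<theta> - \<theta>\<^sub>0)) \<and> (\<forall>\<theta>. v \<theta> = 0) \<and>
          (\<forall>\<theta>. p \<theta> = 2 * f \<theta> + pressure_const (F k)))) \<and>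
    (\<forall>k\<ge>3. \<exists>a b \<kappa> m. 0 < m \<and> m < 1 \<and>
            (\<forall>\<theta>. F k \<theta> = a + b * (jacobi_cn m (\<kappa> * \<theta>))\<^sup>2)) \<and>
    (\<lambda>k. amplitude (F k)) \<in> \<Theta>(\<lambda>k. (real k)\<^sup>2)"
proof (intro exI[of _ flux_solution] conjI allI impI)
  fix k :: nat assume k: "3 \<le> k"
  obtain c where c: "flux_ode c (flux_solution k)" using flux_solution_ode[OF k] by blast
  show "smooth_circle_fun (flux_solution k)"
    unfolding smooth_circle_fun_def
    using flux_ode_smooth[OF c, of 1 0] flux_solution_periodic[OF k] by simp
  show "\<not> flux_solution k constant_on UNIV"
    unfolding flux_solution_def
    by (rule cnoidal_not_constant)
       (use flux_parameter[OF k] flux_solution_frequency_pos[OF k] k in auto)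
  show "minimal_period (flux_solution k) (2 * pi / real k)"
    by (rule flux_solution_minimal_period[OF k])
  show "\<exists>a b \<kappa> m. 0 < m \<and> m < 1 \<and>
      (\<forall>\<theta>. flux_solution k \<theta> = a + b * (jacobi_cn m (\<kappa> * \<theta>))\<^sup>2)"
    unfolding flux_solution_def cnoidal_def using flux_parameter[OF k] by blast
next
  show "(\<lambda>k. amplitude (flux_solution k)) \<in> \<Theta>(\<lambda>k. (real k)\<^sup>2)"
    by (rule flux_solution_amplitude)
next
  fix f v p :: "real \<Rightarrow> real"
  let ?trivial = "(\<forall>\<theta>. f \<theta> = 0) \<and> (\<exists>c. \<forall>\<theta>. v \<theta> = c) \<and> (\<forall>\<theta>. p \<theta> = - \<bar>v \<theta>\<bar>\<^sup>2 / 2)"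
  let ?cnoidal = "\<exists>k\<ge>3. \<exists>\<theta>\<^sub>0. (\<forall>\<theta>. f \<theta> = flux_solution k (\<theta> - \<theta>\<^sub>0)) \<and> (\<forall>\<theta>. v \<theta> = 0) \<and>
      (\<forall>\<theta>. p \<theta> = 2 * f \<theta> + pressure_const (flux_solution k))"
  show "(smooth_circle_fun f \<and> smooth_circle_fun v \<and> smooth_circle_fun p \<and>
      circle_NS f v p \<and> circle_integral f = 0) \<longleftrightarrow> ?trivial \<or> ?cnoidal" (is "?sol \<longleftrightarrow> _")
  proof (intro iffI)
    assume ?sol
    then have sm: "smooth f" "smooth v" "smooth p" and per: "periodic_fun_simple f (2 * pi)"
      and NS: "circle_NS f v p" and zero: "circle_integral f = 0"
      unfolding smooth_circle_fun_def by auto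
    obtain b c where v: "v = (\<lambda>_. b)" and p: "p = (\<lambda>\<theta>. 2 * f \<theta> + c)"
      and ode: "\<And>\<theta>. deriv (deriv f) \<theta> = b * deriv f \<theta> - (f \<theta>)\<^sup>2 - 4 * f \<theta> - (b\<^sup>2 + 2 * c)"
      by (rule circle_NS_reduced[OF sm NS]) blast
    show "?trivial \<or> ?cnoidal"
    proof (cases "f constant_on UNIV")
      case True
      then obtain d where d: "f = (\<lambda>_. d)" unfolding constant_on_def by auto
      have "d = 0" using zero unfolding circle_integral_def d by simp
      \<comment> \<open>With f = 0 the second equation reduces to the balance of pressure and
        tangential velocity.\<close>
      then have "b\<^sup>2 + 2 * c = 0" using ode[of 0] unfolding d by simp
      then have "?trivial" unfolding v p d \<open>d = 0\<close> by simp
      then show ?thesis ..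
    next
      case False
      have b: "b = 0"
        by (rule tangential_velocity_zero[OF smooth_deriv(1)[OF sm(1)] _ per _ False,
              where c = "b\<^sup>2 + 2 * c"])
           (use smooth_deriv(2)[OF sm(1)] in \<open>simp_all add: ode\<close>)
      have ode': "flux_ode c f"
        using smooth_deriv[OF sm(1)] unfolding flux_ode_def ode b by simp
      obtain k a where k: "3 \<le> k" and fk: "\<And>x. f x = flux_solution k (x - a)"
        using zero_flux_solution[OF ode' per False zero] by blast
      \<comment> \<open>Undoing the shift shows that the profile itself solves the equation with the
        same c, which zero flux then identifies.\<close>
      have "flux_solution k = (\<lambda>x. f (x - (- a)))" by (auto simp: fk)
      then have "flux_ode c (flux_solution k)" using flux_ode_shift(1)[OF ode', of "- a"] by simp
      then have "c = pressure_const (flux_solution k)" by (rule flux_solution_pressure[OF k])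
      then have ?cnoidal using k fk unfolding v p b by blast
      then show ?thesis ..
    qed
  next
    assume "?trivial \<or> ?cnoidal"
    then show ?sol
    proof
      assume ?trivial
      then obtain b where fvp: "f = (\<lambda>_. 0)" "v = (\<lambda>_. b)" "p = (\<lambda>_. - b\<^sup>2 / 2)"
        by (auto simp: fun_eq_iff)
      show ?sol
        unfolding fvp smooth_circle_fun_def circle_NS_def circle_integral_def
        by (auto simp: smooth_const periodic_fun_simple_def)
    next
      assume ?cnoidal
      then obtain k a where k: "3 \<le> k" and "\<forall>\<theta>. f \<theta> = flux_solution k (\<theta> - a)" "\<forall>\<theta>. v \<theta> = 0"
        "\<forall>\<theta>. p \<theta> = 2 * f \<theta> + pressure_const (flux_solution k)"
        by blast
      then have f: "f = (\<lambda>\<theta>. flux_solution k (\<theta> - a))" and v: "v = (\<lambda>_. 0)"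
        and p: "p = (\<lambda>\<theta>. 2 * f \<theta> + pressure_const (flux_solution k))"
        by auto
      obtain c where c: "flux_ode c (flux_solution k)" using flux_solution_ode[OF k] by blast
      have ode: "flux_ode c f" unfolding f by (rule flux_ode_shift[OF c])
      \<comment> \<open>The constant of the equation equals the prescribed pressure constant, so the
        second equation of the system holds with this pressure.\<close>
      have p': "p = (\<lambda>\<theta>. 2 * f \<theta> + c)" unfolding p flux_solution_pressure[OF k c] ..
      have per: "f (x + 2 * pi) = f x" for x
        using periodic_fun_simple.plus_period[OF flux_solution_periodic[OF k], of "x - a"]
        by (simp add: f algebra_simps)
      have "deriv (deriv f) \<theta> = - (f \<theta>)\<^sup>2 - 4 * f \<theta> - 2 * c" for \<theta>
        by (rule DERIV_imp_deriv[OF flux_odeD(2)[OF ode]])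
      then have "circle_NS f v p"
        unfolding circle_NS_def v p' by simp
      moreover have "circle_integral f = 0"
        unfolding f by (rule flux_solution_circle_integral[OF k])
      moreover have "smooth_circle_fun f" "smooth_circle_fun p"
        unfolding smooth_circle_fun_def periodic_fun_simple_def p'
        using flux_ode_smooth[OF ode, of 1 0] flux_ode_smooth[OF ode, of 2 c] per by auto
      moreover have "smooth_circle_fun v"
        unfolding smooth_circle_fun_def v by (simp add: smooth_const periodic_fun_simple_def)
      ultimately show ?sol by blast
    qed
  qed
qed

end
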